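(* For every integer $s\ge 4$ and every positive integer $r$, $$R^{\mathrm{KG}}_r(s-1,s)\le r\,R(s-2,s)+2\bigl(R(s-2,s-1)-1\bigr)+2r.$$
   Context: $R(a,b)$ is the classical Ramsey number: the least $n$ such that every red/blue edge-coloring of $K_n$ contains a red $K_a$ or a blue $K_b$. The Kneser graph $\mathrm{KG}(n,r)$ has vertex set the $r$-element subsets of $[n]=\{1,\dots,n\}$, with two sets adjacent iff they are disjoint. The $r$-Kneser Ramsey number $R^{\mathrm{KG}}_r(a,b)$ is the minimum integer $n$ such that every red/blue edge-coloring of $\mathrm{KG}(n,r)$ contains a red $K_a$ (a set of $a$ pairwise adjacent vertices with all connecting edges red) or a blue $K_b$. *)

theory Defs
  imports "HOL-Library.Ramsey"
begin

(* In both definitions colour 0 is red and colour 1 is blue. *)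

definition ramsey_number :: "nat \<Rightarrow> nat \<Rightarrow> nat" where
  "ramsey_number a b = (LEAST n. partn_lst {..<n} [a, b] 2)"

definition kneser_vertices :: "nat \<Rightarrow> nat \<Rightarrow> nat set set" where
  "kneser_vertices n r = nsets {1..n} r"

(* The condition A \<noteq> B only matters for r = 0, where it rules out a loop at {}. *)
definition kneser_edges :: "nat \<Rightarrow> nat \<Rightarrow> nat set set set" where
  "kneser_edges n r =
     {{A, B} | A B. A \<in> kneser_vertices n r \<and> B \<in> kneser_vertices n r \<and> A \<noteq> B \<and> A \<inter> B = {}}"

definition monochromatic_clique ::
    "'v set \<Rightarrow> 'v set set \<Rightarrow> ('v set \<Rightarrow> nat) \<Rightarrow> nat \<Rightarrow> nat \<Rightarrow> bool" where
  "monochromatic_clique V E f i k \<longleftrightarrow>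
     (\<exists>K \<in> nsets V k. \<forall>e \<in> nsets K 2. e \<in> E \<and> f e = i)"

definition kneser_arrows :: "nat \<Rightarrow> nat \<Rightarrow> nat \<Rightarrow> nat \<Rightarrow> bool" where
  "kneser_arrows n r a b \<longleftrightarrow>
     (\<forall>f \<in> kneser_edges n r \<rightarrow> {..<2}.
        monochromatic_clique (kneser_vertices n r) (kneser_edges n r) f 0 a \<or>
        monochromatic_clique (kneser_vertices n r) (kneser_edges n r) f 1 b)"

definition kneser_ramsey_number :: "nat \<Rightarrow> nat \<Rightarrow> nat \<Rightarrow> nat" where
  "kneser_ramsey_number r a b = (LEAST n. kneser_arrows n r a b)"

end

theory Submission
  imports Defs "HOL-Number_Theory.Cong" "HOL-Computational_Algebra.Primes"
begin

text \<open>
  Suppose no monochromatic clique exists and fix a blue edge \<open>AC\<close>. Colour each \<open>r\<close>-set \<open>F\<close> disjoint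
  from \<open>A\<close> and \<open>C\<close> by 0 if \<open>AF\<close> is red, by 1 if \<open>AF\<close> is blue and \<open>CF\<close> is red, and by 2 if both are
  blue. Extending cliques by \<open>A\<close> or \<open>C\<close> shows that there are fewer than \<open>R(s-2,s)\<close>, \<open>R(s-2,s-1)\<close> and
  \<open>R(s-2,s-1)\<close> pairwise disjoint sets of these colours. The Alon--Frankl--Lovasz theorem on colourings
  of Kneser hypergraphs, in a version with unequal matching sizes, contradicts this.

  That theorem is reduced to matchings of equal size by adding points that force a colour, then to
  matchings of prime size \<open>p\<close> by colouring larger sets with the colour of a matching inside them. The
  prime case follows from a \<open>Z\<^sub>p\<close>-Tucker lemma, which is proved by evaluating the standard cup-product
  cocycles of the cyclic group on a sequence of chains whose boundaries are alternately
  \<open>(g - 1)\<close>-multiples and norm multiples of the preceding chain.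
\<close>

section \<open>Chains of flags of sign vectors\<close>

text \<open>Functionals on lists play the role of cochains: \<open>bd\<close> is the coboundary and \<open>prism\<close>, \<open>contraction\<close> are the
  duals of a prism and of a cone operator. Chains are represented by functionals on cochains,
  so that no free modules are needed.\<close>

fun bd :: "('v list \<Rightarrow> int) \<Rightarrow> 'v list \<Rightarrow> int" where
  "bd \<phi> [] = 0"
| "bd \<phi> (x # xs) = \<phi> xs - bd (\<lambda>ys. \<phi> (x # ys)) xs"

fun prism :: "('v \<Rightarrow> 'v) \<Rightarrow> ('v list \<Rightarrow> int) \<Rightarrow> 'v list \<Rightarrow> int" where
  "prism u \<phi> [] = 0"
| "prism u \<phi> (x # xs) = \<phi> (x # u x # map u xs) - prism u (\<lambda>ys. \<phi> (x # ys)) xs"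

definition contraction :: "('v \<Rightarrow> 'v) \<Rightarrow> 'v \<Rightarrow> ('v list \<Rightarrow> int) \<Rightarrow> 'v list \<Rightarrow> int" where
  "contraction u e \<phi> xs = \<phi> (u e # map u xs) - prism u \<phi> xs"

section \<open>Homotopy identities for cochains on lists\<close>

lemma bd_map: "bd (\<lambda>ys. \<phi> (map h ys)) xs = bd \<phi> (map h xs)"
  by (induction xs arbitrary: \<phi>) auto

lemma bd_linear: "bd (\<lambda>ys. a * \<phi> ys + b * \<psi> ys) xs = a * bd \<phi> xs + b * bd \<psi> xs"
  by (induction xs arbitrary: \<phi> \<psi>) (auto simp: algebra_simps)

lemma bd_diff: "bd (\<lambda>ys. \<phi> ys - \<psi> ys) xs = bd \<phi> xs - bd \<psi> xs"
  using bd_linear[of 1 \<phi> "-1" \<psi> xs] by simp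

lemma bd_scale: "bd (\<lambda>ys. c * \<phi> ys) xs = c * bd \<phi> xs"
  using bd_linear[of c \<phi> 0 \<phi> xs] by simp

lemma bd_zero: "bd (\<lambda>ys. 0) xs = 0"
  using bd_scale[of 0] by simp

lemma bd_sum: "bd (\<lambda>ys. \<Sum>j<n. \<phi> j ys) xs = (\<Sum>j<(n::nat). bd (\<phi> j) xs)"
proof (induction n)
  case (Suc n)
  then show ?case
    using bd_linear[of 1 "\<lambda>ys. \<Sum>j<n. \<phi> j ys" 1 "\<phi> n" xs] by simp
qed (simp add: bd_zero)

lemma prism_linear:
  "prism u (\<lambda>ys. a * \<phi> ys + b * \<psi> ys) xs = a * prism u \<phi> xs + b * prism u \<psi> xs"
  by (induction xs arbitrary: \<phi> \<psi>) (auto simp: algebra_simps)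

lemma prism_diff: "prism u (\<lambda>ys. \<phi> ys - \<psi> ys) xs = prism u \<phi> xs - prism u \<psi> xs"
  using prism_linear[of u 1 \<phi> "-1" \<psi> xs] by simp

lemma contraction_linear:
  "contraction u e (\<lambda>ys. a * \<phi> ys + b * \<psi> ys) xs
     = a * contraction u e \<phi> xs + b * contraction u e \<psi> xs"
  by (simp add: contraction_def prism_linear algebra_simps)

text \<open>Unfolded, \<open>prism u \<phi>\<close> is the alternating sum of \<open>\<phi>\<close>
  over the lists that follow \<open>xs\<close> up to an entry \<open>x\<close> and continue with
  \<open>u x\<close> and the images of the later entries. The inner walls of the prism cancel, and
  its two ends remain.\<close>

lemma prism_homotopy:
  "prism u (bd \<phi>) xs + bd (prism u \<phi>) xs = \<phi> (map u xs) - \<phi> xs"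
proof (induction xs arbitrary: \<phi>)
  case (Cons x xs)
  have "prism u (bd \<phi>) (x # xs)
      = \<phi> (u x # map u xs) - \<phi> (x # map u xs) + bd (\<lambda>ys. \<phi> (x # u x # ys)) (map u xs)
        - (prism u \<phi> xs - prism u (bd (\<lambda>ys. \<phi> (x # ys))) xs)"
    by (simp add: prism_diff)
  moreover have "bd (prism u \<phi>) (x # xs)
      = prism u \<phi> xs - (bd (\<lambda>ys. \<phi> (x # u x # ys)) (map u xs) - bd (prism u (\<lambda>ys. \<phi> (x # ys))) xs)"
    using bd_map[of "\<lambda>ys. \<phi> (x # u x # ys)" u xs] by (simp add: bd_diff)
  ultimately show ?case
    using Cons[of "\<lambda>ys. \<phi> (x # ys)"] by simp
qed simp

text \<open>The prism joins \<open>xs\<close> to \<open>map u xs\<close>, and the cone with apex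
  \<open>u e\<close> fills \<open>map u xs\<close>; together they form a null-homotopy. As
  \<open>bd\<close> is augmented (\<open>bd \<phi> [x] = \<phi> []\<close>), this covers the empty
  list and single vertices too.\<close>

lemma contraction_bd:
  "contraction u e (bd \<phi>) xs = \<phi> xs - bd (contraction u e \<phi>) xs"
proof -
  have "contraction u e \<phi> = (\<lambda>ys. \<phi> (u e # map u ys) - prism u \<phi> ys)"
    by (simp add: contraction_def fun_eq_iff)
  hence "bd (contraction u e \<phi>) xs = bd (\<lambda>ys. \<phi> (u e # ys)) (map u xs) - bd (prism u \<phi>) xs"
    using bd_map[of "\<lambda>ys. \<phi> (u e # ys)" u xs] by (simp add: bd_diff)
  thus ?thesis
    using prism_homotopy[of u \<phi> xs] by (simp add: contraction_def)
qed

lemma dvd_prism: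
  assumes "\<And>j. j < length xs \<Longrightarrow> m dvd \<phi> (take (Suc j) xs @ map u (drop j xs))"
  shows "m dvd prism u \<phi> xs"
  using assms
proof (induction xs arbitrary: \<phi>)
  case (Cons x xs)
  have "m dvd \<phi> (x # u x # map u xs)"
    using Cons.prems[of 0] by simp
  moreover have "m dvd prism u (\<lambda>ys. \<phi> (x # ys)) xs"
    using Cons.prems[of "Suc j" for j] by (intro Cons.IH) simp
  ultimately show ?case by simp
qed simp

text \<open>A pair \<open>(x, i)\<close> in a sign vector says that the point \<open>x\<close> has the sign \<open>i\<close> in \<open>Z\<^sub>p\<close>.\<close>

definition rot :: "nat \<Rightarrow> (nat \<times> nat) set \<Rightarrow> (nat \<times> nat) set" where
  "rot p X = map_prod id (\<lambda>i. Suc i mod p) ` X"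

text \<open>The dual of \<open>g - 1\<close> for odd \<open>k\<close> and of the norm
  \<open>1 + g + ... + g^(p-1)\<close> for even \<open>k > 0\<close>, where \<open>g\<close> is the
  rotation: the alternating maps of the periodic resolution of a cyclic group.\<close>

definition twist :: "nat \<Rightarrow> nat \<Rightarrow> ((nat \<times> nat) set list \<Rightarrow> int) \<Rightarrow> (nat \<times> nat) set list \<Rightarrow> int" where
  "twist p k \<phi> xs =
     (if k = 0 then \<phi> xs
      else if odd k then \<phi> (map (rot p) xs) - \<phi> xs
      else (\<Sum>j<p. \<phi> (map (rot p ^^ j) xs)))"

text \<open>Evaluation of \<open>\<phi>\<close> on a chain c_k of flags of length \<open>k\<close>:
  c_0 is the empty list, and c_(k+1) arises from c_k by the twist followed by the null-homotopy
  through the new point \<open>k\<close> with sign 0.\<close>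

primrec chain :: "nat \<Rightarrow> nat \<Rightarrow> ((nat \<times> nat) set list \<Rightarrow> int) \<Rightarrow> int" where
  "chain p 0 \<phi> = \<phi> []"
| "chain p (Suc k) \<phi> = chain p k (twist p k (contraction (insert (k, 0)) {} \<phi>))"

text \<open>A nonzero vector of length \<open>n\<close> with entries in Z_p or blank, stored as the
  graph of its sign function. Flags of such vectors are the simplices of the barycentric subdivision
  of the \<open>n\<close>-fold join of Z_p.\<close>

definition sign_vector :: "nat \<Rightarrow> nat \<Rightarrow> (nat \<times> nat) set \<Rightarrow> bool" where
  "sign_vector p n X \<longleftrightarrow> X \<noteq> {} \<and> X \<subseteq> {..<n} \<times> {..<p} \<and> single_valued X"

definition flag :: "nat \<Rightarrow> nat \<Rightarrow> (nat \<times> nat) set list \<Rightarrow> bool" where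
  "flag p n xs \<longleftrightarrow> sorted_wrt (\<subset>) xs \<and> (\<forall>X \<in> set xs. sign_vector p n X)"

section \<open>Rotations, cones and prisms of flags\<close>

lemma rot_funpow:
  assumes "sign_vector p n X"
  shows "(rot p ^^ j) X = map_prod id (\<lambda>i. (i + j) mod p) ` X"
proof (induction j)
  case 0
  have "map_prod id (\<lambda>i. (i + 0) mod p) z = z" if "z \<in> X" for z
  proof -
    have "snd z < p" using assms that by (auto simp: sign_vector_def)
    thus ?thesis by (cases z) simp
  qed
  hence "map_prod id (\<lambda>i. (i + 0) mod p) ` X = id ` X"
    by (intro image_cong) auto
  thus ?case by (simp add: id_def)
next
  case (Suc j)
  have "(rot p ^^ Suc j) X = rot p (map_prod id (\<lambda>i. (i + j) mod p) ` X)"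
    using Suc by (simp only: funpow.simps comp_apply)
  also have "\<dots> = map_prod id (\<lambda>i. (i + Suc j) mod p) ` X"
    unfolding rot_def image_image
    by (intro image_cong refl) (simp add: map_prod_def mod_Suc_eq split: prod.split)
  finally show ?case .
qed

lemma rot_funpow_p:
  assumes "sign_vector p n X"
  shows "(rot p ^^ p) X = X"
  using rot_funpow[OF assms, of p] rot_funpow[OF assms, of 0] by simp

lemma inj_on_Suc_mod: "inj_on (\<lambda>i. Suc i mod p) {..<p}"
  by (rule inj_onI) (simp add: mod_Suc split: if_splits)

lemma sign_vector_rot:
  assumes "sign_vector p n X"
  shows "sign_vector p n (rot p X)"
proof -
  have "p > 0" if "(x, i) \<in> X" for x i
    using assms that by (auto simp: sign_vector_def)
  moreover have "single_valued (rot p X)"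
    using assms unfolding sign_vector_def single_valued_def rot_def by (auto simp: image_iff) metis
  ultimately show ?thesis
    using assms by (auto simp: sign_vector_def rot_def)
qed

lemma rot_strict_mono:
  assumes "sign_vector p n X" "sign_vector p n Y" "X \<subset> Y"
  shows "rot p X \<subset> rot p Y"
proof -
  have "inj_on (map_prod id (\<lambda>i. Suc i mod p)) ({..<n} \<times> {..<p})"
    by (intro map_prod_inj_on inj_on_Suc_mod) simp
  hence "inj_on (map_prod id (\<lambda>i. Suc i mod p)) Y"
    using assms(2) by (auto simp: sign_vector_def intro: inj_on_subset)
  thus ?thesis
    using assms(3) unfolding rot_def by (rule image_strict_mono)
qed

lemma flag_map:
  assumes "flag p n xs"
    and "\<And>X. sign_vector p n X \<Longrightarrow> sign_vector p n' (h X)"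
    and "\<And>X Y. sign_vector p n X \<Longrightarrow> sign_vector p n Y \<Longrightarrow> X \<subset> Y \<Longrightarrow> h X \<subset> h Y"
  shows "flag p n' (map h xs)"
proof -
  have xs: "sorted_wrt (\<subset>) xs" "\<And>X. X \<in> set xs \<Longrightarrow> sign_vector p n X"
    using assms(1) by (simp_all add: flag_def)
  have "sorted_wrt (\<lambda>X Y. h X \<subset> h Y) xs"
    using xs(1) by (rule sorted_wrt_mono_rel[rotated]) (rule assms(3)[OF xs(2) xs(2)])
  thus ?thesis
    unfolding flag_def sorted_wrt_map using xs(2) assms(2) by simp
qed

lemma flag_rot: "flag p n xs \<Longrightarrow> flag p n (map (rot p) xs)"
  by (erule flag_map) (rule sign_vector_rot rot_strict_mono; assumption)+

lemma flag_rot_funpow: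
  assumes "flag p n xs"
  shows "flag p n (map (rot p ^^ j) xs)"
proof (induction j)
  case (Suc j)
  have "map (rot p ^^ Suc j) xs = map (rot p) (map (rot p ^^ j) xs)" by simp
  thus ?case using flag_rot[OF Suc] by metis
qed (use assms in simp)

lemma sign_vector_insert:
  assumes "sign_vector p n X \<or> X = {}" "p > 0"
  shows "sign_vector p (Suc n) (insert (n, 0) X)"
proof -
  have X: "X \<subseteq> {..<n} \<times> {..<p}" "single_valued X"
    using assms by (auto simp: sign_vector_def)
  hence "(n, i) \<notin> X" for i by auto
  hence "single_valued (insert (n, 0) X)"
    using X(2) unfolding single_valued_def by blast
  thus ?thesis
    using X(1) assms(2) by (auto simp: sign_vector_def)
qed

lemma sign_vector_Suc: "sign_vector p n X \<Longrightarrow> sign_vector p (Suc n) X"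
  unfolding sign_vector_def by auto

lemma sign_vector_notin: "sign_vector p n X \<Longrightarrow> (n, 0) \<notin> X"
  unfolding sign_vector_def by auto

lemma flag_map_insert:
  assumes "flag p n xs" "p > 0"
  shows "flag p (Suc n) (map (insert (n, 0)) xs)"
  using assms(1)
proof (rule flag_map)
  show "insert (n, 0) X \<subset> insert (n, 0) Y"
    if "sign_vector p n X" "sign_vector p n Y" "X \<subset> Y" for X Y
    using that sign_vector_notin[of p n X] sign_vector_notin[of p n Y]
    unfolding psubset_eq by (simp add: insert_ident subset_insertI2)
qed (use assms(2) in \<open>simp add: sign_vector_insert\<close>)

lemma flag_cone:
  assumes "flag p n xs" "p > 0"
  shows "flag p (Suc n) (insert (n, 0) {} # map (insert (n, 0)) xs)"
proof -
  have "{(n, 0)} \<subset> insert (n, 0) X" if "X \<in> set xs" for X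
  proof -
    have X: "sign_vector p n X"
      using assms(1) that by (simp add: flag_def)
    hence "(n, 0) \<notin> X" by (rule sign_vector_notin)
    moreover have "X \<noteq> {}" using X by (simp add: sign_vector_def)
    ultimately show ?thesis by auto
  qed
  moreover have "sign_vector p (Suc n) {(n, 0)}"
    using sign_vector_insert[of p n "{}"] assms by simp
  ultimately show ?thesis
    using flag_map_insert[OF assms] unfolding flag_def by auto
qed

text \<open>The entry \<open>xs ! j\<close> occurs both bare and with the new point; the inclusion
  is strict because no sign vector on \<open>n\<close> points contains
  \<open>(n, 0)\<close>.\<close>

lemma flag_prism:
  assumes "flag p n xs" "p > 0" "j < length xs"
  shows "flag p (Suc n) (take (Suc j) xs @ map (insert (n, 0)) (drop j xs))"
proof -
  have sorted: "sorted_wrt (\<subset>) xs" using assms by (simp add: flag_def)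
  have "flag p n (drop j xs)"
    using assms(1) by (auto simp: flag_def sorted_wrt_drop dest: in_set_dropD)
  hence 1: "flag p (Suc n) (map (insert (n, 0)) (drop j xs))"
    using assms by (intro flag_map_insert)
  have 2: "flag p (Suc n) (take (Suc j) xs)"
    using assms(1) by (auto simp: flag_def sorted_wrt_take dest!: in_set_takeD intro: sign_vector_Suc)
  have 3: "X \<subset> insert (n, 0) Y" if XY: "X \<in> set (take (Suc j) xs)" "Y \<in> set (drop j xs)" for X Y
  proof -
    obtain i where "i < length (take (Suc j) xs)" "take (Suc j) xs ! i = X"
      using XY(1) by (auto simp: in_set_conv_nth)
    hence i: "i < length xs" "i \<le> j" "X = xs ! i"
      by simp_all
    obtain l where "l < length (drop j xs)" "drop j xs ! l = Y"
      using XY(2) by (auto simp: in_set_conv_nth)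
    hence l: "j + l < length xs" "Y = xs ! (j + l)"
      using assms(3) by (simp_all add: less_diff_conv add.commute)
    have "X \<subseteq> Y"
    proof (cases "i = j + l")
      case False
      hence "xs ! i \<subset> xs ! (j + l)"
        using i l by (intro sorted_wrt_nth_less[OF sorted]) simp_all
      thus ?thesis using i l by simp
    qed (simp add: i l)
    moreover have "(n, 0) \<notin> X"
      using i assms(1) by (intro sign_vector_notin[of p]) (simp add: flag_def)
    ultimately show ?thesis by auto
  qed
  show ?thesis
    using 1 2 3 unfolding flag_def by (simp add: sorted_wrt_append ball_Un)
qed

section \<open>Support and boundary of the chains\<close>

lemma dvd_twist:
  assumes "\<And>xs. flag p n xs \<Longrightarrow> length xs = l \<Longrightarrow> m dvd \<phi> xs"
    and "flag p n xs" "length xs = l"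
  shows "m dvd twist p k \<phi> xs"
proof -
  have "m dvd \<phi> (map (rot p ^^ j) xs)" for j
    using assms(3) by (intro assms(1) flag_rot_funpow[OF assms(2)]) simp
  moreover have "m dvd \<phi> (map (rot p) xs)"
    using assms(3) by (intro assms(1) flag_rot[OF assms(2)]) simp
  ultimately show ?thesis
    using assms(1)[OF assms(2,3)] by (simp add: twist_def dvd_sum)
qed

text \<open>The chain is supported on flags of \<open>k\<close> vectors on \<open>k\<close> points,
  as cone and prism each add one vector and one point. Divisibility by \<open>m\<close> treats
  congruences and, with \<open>m = 0\<close>, exact vanishing at once.\<close>

lemma dvd_chain:
  assumes "p > 0" "\<And>xs. flag p k xs \<Longrightarrow> length xs = k \<Longrightarrow> m dvd \<phi> xs"
  shows "m dvd chain p k \<phi>"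
  using assms(2)
proof (induction k arbitrary: \<phi>)
  case 0
  thus ?case by (simp add: flag_def)
next
  case (Suc k)
  have *: "m dvd contraction (insert (k, 0)) {} \<phi> xs" if "flag p k xs" "length xs = k" for xs
    unfolding contraction_def
    using that assms(1) flag_cone[of p k xs] flag_prism[of p k xs]
    by (intro dvd_diff dvd_prism) (auto intro!: Suc.prems)
  have "m dvd twist p k (contraction (insert (k, 0)) {} \<phi>) xs" if "flag p k xs" "length xs = k" for xs
    by (rule dvd_twist[OF _ that]) (rule *)
  thus ?case using Suc.IH by simp
qed

lemma twist_linear:
  "twist p k (\<lambda>ys. a * \<phi> ys + b * \<psi> ys) xs = a * twist p k \<phi> xs + b * twist p k \<psi> xs"
  unfolding twist_def by (simp add: right_diff_distrib sum.distrib flip: sum_distrib_left)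

lemma chain_linear:
  "chain p k (\<lambda>ys. a * \<phi> ys + b * \<psi> ys) = a * chain p k \<phi> + b * chain p k \<psi>"
proof (induction k arbitrary: \<phi> \<psi>)
  case (Suc k)
  have "twist p k (contraction (insert (k, 0)) {} (\<lambda>ys. a * \<phi> ys + b * \<psi> ys))
      = (\<lambda>xs. a * twist p k (contraction (insert (k, 0)) {} \<phi>) xs
            + b * twist p k (contraction (insert (k, 0)) {} \<psi>) xs)"
    by (simp add: contraction_linear[abs_def] twist_linear[abs_def])
  thus ?case using Suc by simp
qed simp

lemma chain_diff: "chain p k (\<lambda>ys. \<phi> ys - \<psi> ys) = chain p k \<phi> - chain p k \<psi>"
  using chain_linear[of p k 1 \<phi> "-1" \<psi>] by simp

lemma chain_scale: "chain p k (\<lambda>ys. c * \<phi> ys) = c * chain p k \<phi>"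
  using chain_linear[of p k c \<phi> 0 \<phi>] by simp

lemma chain_cong:
  assumes "p > 0" "\<And>xs. flag p k xs \<Longrightarrow> length xs = k \<Longrightarrow> [\<phi> xs = \<psi> xs] (mod m)"
  shows "[chain p k \<phi> = chain p k \<psi>] (mod m)"
  using dvd_chain[of p k m "\<lambda>xs. \<phi> xs - \<psi> xs"] assms
  by (simp add: chain_diff cong_iff_dvd_diff)

lemma twist_bd: "twist p k (bd \<phi>) = bd (twist p k \<phi>)"
proof
  fix xs
  have "twist p k \<phi> = (\<lambda>xs. if k = 0 then \<phi> xs
      else if odd k then \<phi> (map (rot p) xs) - \<phi> xs
      else (\<Sum>j<p. \<phi> (map (rot p ^^ j) xs)))"
    by (simp add: twist_def fun_eq_iff)
  thus "twist p k (bd \<phi>) xs = bd (twist p k \<phi>) xs"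
    by (cases "k = 0"; cases "odd k")
       (simp_all add: twist_def bd_diff bd_sum bd_map[of \<phi> "rot p" xs]
          bd_map[of \<phi> "rot p ^^ j" xs for j])
qed

text \<open>The product of \<open>g - 1\<close> and the norm, in either order, telescopes to
  \<open>g^p - 1\<close>, which is 0 on flags.\<close>

lemma twist_twist:
  assumes "flag p n xs" "k > 0"
  shows "twist p k (twist p (Suc k) \<phi>) xs = 0"
proof -
  have "(\<Sum>j<p. \<phi> (map (rot p ^^ Suc j) xs) - \<phi> (map (rot p ^^ j) xs))
      = \<phi> (map (rot p ^^ p) xs) - \<phi> (map (rot p ^^ 0) xs)"
    by (rule sum_lessThan_telescope)
  also have "map (rot p ^^ p) xs = xs"
    using assms(1) using rot_funpow_p[of p n] by (intro map_idI) (simp only: flag_def)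
  finally have *: "(\<Sum>j<p. \<phi> (map (rot p ^^ Suc j) xs) - \<phi> (map (rot p ^^ j) xs)) = 0"
    by (simp only: funpow.simps(1) list.map_id diff_self)
  have 1: "map (rot p ^^ j) (map (rot p) xs) = map (rot p ^^ Suc j) xs" for j
    by (simp only: funpow_Suc_right map_map)
  have 2: "map (rot p) (map (rot p ^^ j) xs) = map (rot p ^^ Suc j) xs" for j
    by (simp only: funpow.simps map_map)
  show ?thesis
  proof (cases "odd k")
    case True
    have "twist p k (twist p (Suc k) \<phi>) xs
        = (\<Sum>j<p. \<phi> (map (rot p ^^ j) (map (rot p) xs))) - (\<Sum>j<p. \<phi> (map (rot p ^^ j) xs))"
      using True assms(2) unfolding twist_def by (simp del: map_map)
    thus ?thesis using * by (simp only: 1 sum_subtractf)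
  next
    case False
    have "twist p k (twist p (Suc k) \<phi>) xs
        = (\<Sum>j<p. \<phi> (map (rot p) (map (rot p ^^ j) xs)) - \<phi> (map (rot p ^^ j) xs))"
      using False assms(2) unfolding twist_def by (simp del: map_map)
    thus ?thesis using * by (simp only: 2)
  qed
qed

text \<open>Dually, the boundary of c_(k+1) is the twist of c_k. The homotopy identity leaves an
  error term that involves the boundary of the twisted c_k; by induction that boundary is a product
  of two consecutive twists, hence 0.\<close>

lemma chain_bd:
  assumes "p > 0"
  shows "chain p (Suc k) (bd \<phi>) = chain p k (twist p k \<phi>)"
proof (induction k arbitrary: \<phi>)
  case 0
  show ?case by (simp add: twist_def contraction_bd)
next
  case (Suc k)
  define \<psi> where "\<psi> = contraction (insert (Suc k, 0)) {} \<phi>"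
  have "contraction (insert (Suc k, 0)) {} (bd \<phi>) = (\<lambda>xs. 1 * \<phi> xs + (-1) * bd \<psi> xs)"
    by (simp add: contraction_bd fun_eq_iff \<psi>_def)
  hence "chain p (Suc (Suc k)) (bd \<phi>)
      = chain p (Suc k) (twist p (Suc k) (\<lambda>xs. 1 * \<phi> xs + (-1) * bd \<psi> xs))"
    by simp
  also have "\<dots> = chain p (Suc k) (twist p (Suc k) \<phi>) - chain p (Suc k) (bd (twist p (Suc k) \<psi>))"
    using chain_linear[of p "Suc k" 1 "twist p (Suc k) \<phi>" "-1" "twist p (Suc k) (bd \<psi>)"]
    unfolding twist_linear[abs_def] twist_bd[symmetric] by simp
  also have "chain p (Suc k) (bd (twist p (Suc k) \<psi>)) = chain p k (twist p k (twist p (Suc k) \<psi>))"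
    by (rule Suc.IH)
  also have "\<dots> = 0"
  \<comment> \<open>For \<open>k = 0\<close> nothing telescopes: \<open>twist p 0\<close> is the
    identity, and the twist of index 1 vanishes on the empty list, which rotation fixes.\<close>
  proof (cases "k = 0")
    case False
    have "0 dvd chain p k (twist p k (twist p (Suc k) \<psi>))"
      using twist_twist False assms by (intro dvd_chain) auto
    thus ?thesis by simp
  qed (simp add: twist_def)
  finally show ?case by simp
qed

section \<open>Cocycles of the cyclic group\<close>

text \<open>The \<open>carry\<close> of an addition in \<open>Z\<^sub>p\<close> represents the generator of the second cohomology group;
  \<open>cocycle\<close> multiplies such classes, with a last factor of degree 1 on lists of even length.\<close>

definition carry :: "int \<Rightarrow> int \<Rightarrow> int \<Rightarrow> int \<Rightarrow> int" where
  "carry p a b c = ((b - a) mod p + (c - b) mod p - (c - a) mod p) div p"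

fun cocycle :: "int \<Rightarrow> int list \<Rightarrow> int" where
  "cocycle p (a # b # c # xs) = carry p a b c * cocycle p (c # xs)"
| "cocycle p [a, b] = (b - a) mod p"
| "cocycle p _ = 1"

text \<open>The division in \<open>carry\<close> is exact, so \<open>p * carry\<close> is the
  coboundary of the integer cochain \<open>(b - a) mod p\<close>.\<close>

lemma carry_mult: "p * carry p a b c = (b - a) mod p + (c - b) mod p - (c - a) mod p"
proof -
  have "[(b - a) mod p + (c - b) mod p - (c - a) mod p = (b - a) + (c - b) - (c - a)] (mod p)"
    by (intro cong_diff cong_add) (simp_all add: cong_def)
  hence "p dvd (b - a) mod p + (c - b) mod p - (c - a) mod p"
    by (simp add: cong_0_iff)
  thus ?thesis by (simp add: carry_def)
qed

text \<open>After multiplication by \<open>p\<close> this says that the coboundary of a coboundary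
  vanishes; over the integers \<open>p\<close> can be cancelled.\<close>

lemma carry_cocycle:
  assumes "p \<noteq> 0"
  shows "carry p b c d - carry p a c d + carry p a b d = carry p a b c"
proof -
  have "p * (carry p b c d - carry p a c d + carry p a b d) = p * carry p a b c"
    by (simp only: distrib_left right_diff_distrib carry_mult)
  thus ?thesis using assms by simp
qed

text \<open>The \<open>carry\<close> factors are cocycles, so only the last factor of degree 1
  contributes, and its coboundary is \<open>p * carry\<close>. Length 1 is excluded because the
  augmentation makes the left side 1 there.\<close>

lemma bd_cocycle:
  assumes "p \<noteq> 0" "odd (length ss)" "length ss \<noteq> 1"
  shows "bd (cocycle p) ss = p * cocycle p ss"
  using assms(2,3)
proof (induction ss rule: induct_list012)
  case (3 a b ss)
  obtain c ss' where ss: "ss = c # ss'"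
    using "3.prems"(1) by (cases ss) simp_all
  show ?case
  proof (cases ss')
    case Nil
    thus ?thesis using ss by (simp add: carry_mult)
  next
    case (Cons d xs)
    have "bd (cocycle p) (a # b # c # d # xs)
        = cocycle p (b # c # d # xs) - (cocycle p (a # c # d # xs) - (cocycle p (a # b # d # xs)
          - bd (\<lambda>ys. cocycle p (a # b # c # ys)) (d # xs)))"
      by (simp only: bd.simps)
    also have "\<dots> = (carry p b c d - carry p a c d + carry p a b d) * cocycle p (d # xs)
          - carry p a b c * bd (\<lambda>ys. cocycle p (c # ys)) (d # xs)"
      by (simp only: cocycle.simps(1) bd_scale) (simp only: algebra_simps)
    also have "\<dots> = carry p a b c * bd (cocycle p) (c # d # xs)"
      unfolding carry_cocycle[OF assms(1)] bd.simps(2)[of _ c] by (simp only: algebra_simps)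
    also have "\<dots> = carry p a b c * (p * cocycle p (c # d # xs))"
    proof -
      have "bd (cocycle p) (c # d # xs) = p * cocycle p (c # d # xs)"
        using "3.IH"(1) "3.prems"(1) unfolding ss Cons by simp
      thus ?thesis by (simp only:)
    qed
    also have "\<dots> = p * cocycle p (a # b # c # d # xs)"
      by (simp only: cocycle.simps(1) mult.left_commute)
    finally show ?thesis by (simp only: ss Cons)
  qed
qed auto

text \<open>On lists of odd length, a primitive modulo \<open>p\<close> of the cocycle with one more
  argument. Shifting all entries by 1 adds \<open>cocycle p ss\<close> to it, and this is what
  \<open>g - 1\<close> extracts.\<close>

definition weighted_cocycle :: "int \<Rightarrow> int list \<Rightarrow> int" where
  "weighted_cocycle p ss = cocycle p ss * last ss"

lemma bd_weighted_cocycle: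
  assumes "p \<noteq> 0" "even (length ss)" "ss \<noteq> []"
  shows "[bd (weighted_cocycle p) ss = cocycle p ss] (mod p)"
  using assms(2,3)
proof (induction ss rule: induct_list012)
  case (3 a b ss)
  show ?case
  proof (cases ss)
    case Nil
    thus ?thesis by (simp add: weighted_cocycle_def cong_def)
  next
    case (Cons c ss')
    then obtain d xs where ss': "ss' = d # xs"
      using "3.prems"(1) by (cases ss') simp_all
    have peel: "weighted_cocycle p (x # y # z # zs) = carry p x y z * weighted_cocycle p (z # zs)"
      for x y z zs
      unfolding weighted_cocycle_def by (simp only: cocycle.simps(1) mult.assoc last.simps list.simps if_False)
    have "bd (weighted_cocycle p) (a # b # c # d # xs)
        = weighted_cocycle p (b # c # d # xs) - (weighted_cocycle p (a # c # d # xs)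
          - (weighted_cocycle p (a # b # d # xs)
          - bd (\<lambda>ys. weighted_cocycle p (a # b # c # ys)) (d # xs)))"
      by (simp only: bd.simps)
    also have "\<dots> = (carry p b c d - carry p a c d + carry p a b d) * weighted_cocycle p (d # xs)
          - carry p a b c * bd (\<lambda>ys. weighted_cocycle p (c # ys)) (d # xs)"
      by (simp only: peel bd_scale) (simp only: algebra_simps)
    also have "\<dots> = carry p a b c * bd (weighted_cocycle p) (c # d # xs)"
      unfolding carry_cocycle[OF assms(1)] bd.simps(2)[of _ c] by (simp only: algebra_simps)
    finally have *: "bd (weighted_cocycle p) (a # b # c # d # xs)
        = carry p a b c * bd (weighted_cocycle p) (c # d # xs)" .
    have "[bd (weighted_cocycle p) (c # d # xs) = cocycle p (c # d # xs)] (mod p)"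
      using "3.IH"(1) "3.prems"(1) unfolding Cons ss' by simp
    thus ?thesis
      unfolding Cons ss' * cocycle.simps(1) by (rule cong_scalar_left)
  qed
qed simp_all

lemma cocycle_translate:
  assumes "list_all2 (\<lambda>a b. [b = a + 1] (mod p)) ss ts"
  shows "cocycle p ts = cocycle p ss"
proof -
  have d: "(b' - a') mod p = (b - a) mod p"
    if "[a' = a + 1] (mod p)" "[b' = b + 1] (mod p)" for a a' b b' p :: int
    using cong_diff[OF that(2,1)] by (simp add: cong_def)
  show ?thesis
    using assms
  proof (induction p ss arbitrary: ts rule: cocycle.induct)
    case (1 p a b c xs)
    then obtain a' b' c' xs' where ts: "ts = a' # b' # c' # xs'"
      "[a' = a + 1] (mod p)" "[b' = b + 1] (mod p)" "[c' = c + 1] (mod p)"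
      "list_all2 (\<lambda>a b. [b = a + 1] (mod p)) xs xs'"
      by (auto simp: list_all2_Cons1)
    hence "cocycle p (c' # xs') = cocycle p (c # xs)"
      by (intro "1.IH") simp
    moreover have "carry p a' b' c' = carry p a b c"
      unfolding carry_def d[OF ts(2,3)] d[OF ts(3,4)] d[OF ts(2,4)] by (rule refl)
    ultimately show ?case using ts by simp
  next
    case (2 p a b)
    thus ?case by (auto simp: list_all2_Cons1 intro: d)
  qed (auto simp: list_all2_Cons1)
qed

text \<open>Any two neighbouring entries are arguments of a common factor, and that factor vanishes
  when they agree.\<close>

lemma cocycle_degenerate:
  assumes "Suc i < length ss" "ss ! i = ss ! Suc i"
  shows "cocycle p ss = 0"
  using assms
proof (induction p ss arbitrary: i rule: cocycle.induct)
  case (1 p a b c xs)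
  consider "i = 0" | "i = 1" | j where "i = Suc (Suc j)"
    by (metis One_nat_def not0_implies_Suc)
  thus ?case
  proof cases
    case 3
    hence "cocycle p (c # xs) = 0"
      using 1 by simp
    thus ?thesis by simp
  qed (use 1 in \<open>simp_all add: carry_def\<close>)
qed simp_all

section \<open>The Z_p-Tucker lemma\<close>

lemma sign_vector_mono: "sign_vector p n X \<Longrightarrow> n \<le> n' \<Longrightarrow> sign_vector p n' X"
  unfolding sign_vector_def by auto

lemma flag_translate:
  assumes "flag p k xs" "k \<le> n"
    and "\<And>X. sign_vector p n X \<Longrightarrow> [s (rot p X) = s X + 1] (mod int p)"
  shows "list_all2 (\<lambda>a b. [b = a + 1] (mod int p)) (map s xs) (map s (map (rot p) xs))"
proof -
  have "sign_vector p n X" if "X \<in> set xs" for X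
    using assms(1,2) that by (auto simp: flag_def intro: sign_vector_mono)
  thus ?thesis
    using assms(3) by (simp add: list_all2_conv_all_nth)
qed

text \<open>The pairing is computed by descending in dimension: \<open>chain_bd\<close> trades a
  boundary for a twist, and each step preserves the value modulo \<open>p\<close>, down to the
  single vertex of c_1, where it is 1.\<close>

lemma chain_cocycle:
  assumes "p > 0" "Suc k \<le> n"
    and "\<And>X. sign_vector p n X \<Longrightarrow> [s (rot p X) = s X + 1] (mod int p)"
  shows "[chain p (Suc k) (\<lambda>xs. cocycle (int p) (map s xs)) = 1] (mod int p)"
  using assms(2)
proof (induction k)
  case 0
  show ?case by (simp add: twist_def contraction_def)
next
  case (Suc k)
  define m where "m = Suc k"
  define \<phi> where "\<phi> = (\<lambda>xs. cocycle (int p) (map s xs))"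
  define \<psi> where "\<psi> = (\<lambda>xs. weighted_cocycle (int p) (map s xs))"
  have IH: "[chain p m \<phi> = 1] (mod int p)"
    using Suc by (simp only: m_def \<phi>_def)
  have invariant: "\<phi> (map (rot p) xs) = \<phi> xs" if "flag p m xs" for xs
    unfolding \<phi>_def using that Suc.prems assms(3)
    by (intro cocycle_translate flag_translate[of p m _ n]) (simp_all add: m_def)
  have "[chain p (Suc m) \<phi> = chain p m \<phi>] (mod int p)"
  proof (cases "odd m")
    case True
    \<comment> \<open>For odd \<open>m\<close> the twist is \<open>g - 1\<close>; applied to the
      primitive \<open>\<psi>\<close> it gives \<open>\<phi>\<close> times the increase of the last
      sign, which is 1 modulo \<open>p\<close>.\<close>
    have "[chain p (Suc m) \<phi> = chain p (Suc m) (bd \<psi>)] (mod int p)"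
    proof (rule chain_cong[OF assms(1)])
      fix xs assume xs: "flag p (Suc m) xs" "length xs = Suc m"
      have "bd \<psi> xs = bd (weighted_cocycle (int p)) (map s xs)"
        unfolding \<psi>_def by (rule bd_map)
      thus "[\<phi> xs = bd \<psi> xs] (mod int p)"
        unfolding \<phi>_def using True xs assms(1) by (auto intro!: cong_sym[OF bd_weighted_cocycle])
    qed
    also have "chain p (Suc m) (bd \<psi>) = chain p m (twist p m \<psi>)"
      by (rule chain_bd[OF assms(1)])
    also have "[\<dots> = chain p m \<phi>] (mod int p)"
    proof (rule chain_cong[OF assms(1)])
      fix xs assume xs: "flag p m xs" "length xs = m"
      hence "xs \<noteq> []" by (auto simp: m_def)
      hence last: "last (map s (map (rot p) xs)) = s (rot p (last xs))" "last (map s xs) = s (last xs)"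
        by (simp_all add: last_map)
      have "sign_vector p m (last xs)"
        using xs \<open>xs \<noteq> []\<close> by (simp add: flag_def)
      hence "sign_vector p n (last xs)"
        by (rule sign_vector_mono) (use Suc.prems in \<open>simp add: m_def\<close>)
      hence "[\<phi> xs * s (rot p (last xs)) - \<phi> xs * s (last xs)
            = \<phi> xs * (s (last xs) + 1) - \<phi> xs * s (last xs)] (mod int p)"
        using assms(3) by (intro cong_diff cong_scalar_left cong_refl)
      moreover have "twist p m \<psi> xs = \<phi> xs * s (rot p (last xs)) - \<phi> xs * s (last xs)"
        using True odd_pos[OF True] invariant[OF xs(1)] last
        unfolding twist_def \<psi>_def \<phi>_def weighted_cocycle_def by (simp del: map_map)
      ultimately show "[twist p m \<psi> xs = \<phi> xs] (mod int p)"
        by (simp add: distrib_left)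
    qed
    finally show ?thesis .
  next
    case False
    \<comment> \<open>For even \<open>m\<close> the twist is the norm, which multiplies the
      invariant \<open>\<phi>\<close> by \<open>p\<close>, while \<open>bd \<phi>\<close> is
      \<open>p\<close> times \<open>\<phi>\<close>. Congruences modulo 0 are equalities; this form
      lets \<open>chain_cong\<close> apply and \<open>p\<close> be cancelled.\<close>
    have "int p * chain p (Suc m) \<phi> = chain p (Suc m) (\<lambda>xs. int p * \<phi> xs)"
      by (simp only: chain_scale)
    also have "[\<dots> = chain p (Suc m) (bd \<phi>)] (mod 0)"
    proof (rule chain_cong[OF assms(1)])
      fix xs assume xs: "flag p (Suc m) xs" "length xs = Suc m"
      have "bd \<phi> xs = bd (cocycle (int p)) (map s xs)"
        unfolding \<phi>_def by (rule bd_map)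
      also have "\<dots> = int p * \<phi> xs"
        unfolding \<phi>_def using False xs assms(1) by (intro bd_cocycle) (auto simp: m_def)
      finally show "[int p * \<phi> xs = bd \<phi> xs] (mod 0)" by simp
    qed
    also have "chain p (Suc m) (bd \<phi>) = chain p m (twist p m \<phi>)"
      by (rule chain_bd[OF assms(1)])
    also have "[\<dots> = chain p m (\<lambda>xs. int p * \<phi> xs)] (mod 0)"
    proof (rule chain_cong[OF assms(1)])
      fix xs assume xs: "flag p m xs" "length xs = m"
      have "\<phi> (map (rot p ^^ j) xs) = \<phi> xs" for j
      proof (induction j)
        case (Suc j)
        have "map (rot p ^^ Suc j) xs = map (rot p) (map (rot p ^^ j) xs)"
          by (simp only: funpow.simps map_map)
        thus ?case
          using invariant[OF flag_rot_funpow[OF xs(1)], of j] Suc by (simp only:)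
      qed (simp only: funpow.simps list.map_id)
      thus "[twist p m \<phi> xs = int p * \<phi> xs] (mod 0)"
        using False by (simp add: twist_def m_def)
    qed
    also have "chain p m (\<lambda>xs. int p * \<phi> xs) = int p * chain p m \<phi>"
      by (simp only: chain_scale)
    finally have "chain p (Suc m) \<phi> = chain p m \<phi>"
      using assms(1) by simp
    thus ?thesis by simp
  qed
  from cong_trans[OF this IH] show ?case
    by (simp only: m_def \<phi>_def)
qed

text \<open>A maximal flag has \<open>n\<close> members but only \<open>n - 1\<close> levels are
  available, so two neighbours share level and sign, and the pulled-back cocycle vanishes on the
  flag. This contradicts the value 1 modulo \<open>p\<close> from
  \<open>chain_cocycle\<close>.\<close>

lemma zp_tucker:
  fixes s :: "(nat \<times> nat) set \<Rightarrow> int" and level :: "(nat \<times> nat) set \<Rightarrow> nat"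
  assumes "p \<ge> 2" "n \<ge> 1"
    and equivariant: "\<And>X. sign_vector p n X \<Longrightarrow> [s (rot p X) = s X + 1] (mod int p)"
    and range: "\<And>X. sign_vector p n X \<Longrightarrow> 1 \<le> level X \<and> level X < n"
    and mono: "\<And>X Y. sign_vector p n X \<Longrightarrow> sign_vector p n Y \<Longrightarrow> X \<subset> Y \<Longrightarrow> level X \<le> level Y"
    and same: "\<And>X Y. sign_vector p n X \<Longrightarrow> sign_vector p n Y \<Longrightarrow> X \<subset> Y \<Longrightarrow>
                 level X = level Y \<Longrightarrow> s X = s Y"
  shows False
proof -
  obtain k where k: "n = Suc k" using assms(2) by (cases n) auto
  have "cocycle (int p) (map s xs) = 0" if xs: "flag p n xs" "length xs = n" for xs
  proof -
    have sv: "sign_vector p n (xs ! i)" if "i < n" for i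
      using xs that by (simp add: flag_def)
    have less: "xs ! i \<subset> xs ! Suc i" if "Suc i < n" for i
      using xs that by (intro sorted_wrt_nth_less[of "(\<subset>)"]) (simp_all add: flag_def)
    have "\<exists>i. Suc i < n \<and> level (xs ! i) = level (xs ! Suc i)"
    proof (rule ccontr)
      assume neg: "\<not> ?thesis"
      \<comment> \<open>If neighbouring levels always differed, they would increase strictly from at
        least 1, and the last would reach \<open>n\<close>.\<close>
      have "Suc i \<le> level (xs ! i)" if "i < n" for i
        using that
      proof (induction i)
        case 0
        show ?case using range[OF sv[OF 0]] by simp
      next
        case (Suc i)
        hence "level (xs ! i) \<le> level (xs ! Suc i)"
          by (intro mono sv less) simp_all
        moreover have "level (xs ! i) \<noteq> level (xs ! Suc i)"
          using neg Suc.prems by blast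
        ultimately show ?case using Suc by simp
      qed
      from this[of k] range[OF sv, of k] show False using k by simp
    qed
    then obtain i where i: "Suc i < n" "level (xs ! i) = level (xs ! Suc i)" by blast
    hence "s (xs ! i) = s (xs ! Suc i)"
      by (intro same sv less) simp_all
    thus ?thesis
      using i xs by (intro cocycle_degenerate[of i]) simp_all
  qed
  hence "0 dvd chain p n (\<lambda>xs. cocycle (int p) (map s xs))"
    using assms(1) by (intro dvd_chain) simp_all
  moreover have "[chain p (Suc k) (\<lambda>xs. cocycle (int p) (map s xs)) = 1] (mod int p)"
    using assms(1) k by (intro chain_cocycle[where n = n] equivariant) simp_all
  ultimately have "[0 = 1] (mod int p)" using k by simp
  thus False using assms(1) by (simp add: cong_def)
qed

section \<open>Kneser hypergraphs\<close>

definition has_matching :: "'a set \<Rightarrow> nat \<Rightarrow> ('a set \<Rightarrow> nat) \<Rightarrow> nat \<Rightarrow> nat \<Rightarrow> bool" where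
  "has_matching V r f c k \<longleftrightarrow>
     (\<exists>M. M \<subseteq> nsets V r \<and> finite M \<and> card M = k \<and> pairwise disjnt M \<and> (\<forall>F \<in> M. f F = c))"

lemma has_matching_mono: "has_matching V r f c k \<Longrightarrow> V \<subseteq> W \<Longrightarrow> has_matching W r f c k"
  using nsets_mono[of V W r] unfolding has_matching_def by (elim exE conjE) (intro exI conjI; blast)

section \<open>Equivariant invariants of a colouring\<close>

definition part :: "(nat \<times> nat) set \<Rightarrow> nat \<Rightarrow> nat set" where
  "part X i = {x. (x, i) \<in> X}"

definition colour_parts :: "nat \<Rightarrow> nat \<Rightarrow> (nat set \<Rightarrow> nat) \<Rightarrow> nat \<Rightarrow> (nat \<times> nat) set \<Rightarrow> nat set" where
  "colour_parts p r f c X = {i. i < p \<and> (\<exists>F \<in> nsets (part X i) r. f F = c)}"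

lemma part_rot:
  assumes "sign_vector p n X" "i < p"
  shows "part (rot p X) (Suc i mod p) = part X i"
proof -
  have "j = i" if "(x, j) \<in> X" "Suc i mod p = Suc j mod p" for x j
  proof -
    have "j < p" using assms(1) that(1) by (auto simp: sign_vector_def)
    thus ?thesis
      using inj_onD[OF inj_on_Suc_mod that(2)] assms(2) by simp
  qed
  thus ?thesis
    unfolding part_def rot_def by force
qed

lemma colour_parts_rot:
  assumes "sign_vector p n X"
  shows "colour_parts p r f c (rot p X) = (\<lambda>i. Suc i mod p) ` colour_parts p r f c X"
proof (intro set_eqI iffI)
  fix j assume j: "j \<in> colour_parts p r f c (rot p X)"
  hence "j < p" by (simp add: colour_parts_def)
  moreover have "(\<lambda>i. Suc i mod p) ` {..<p} = {..<p}"
    using \<open>j < p\<close> by (intro card_subset_eq) (auto simp: card_image inj_on_Suc_mod)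
  ultimately obtain i where i: "i < p" "j = Suc i mod p"
    by blast
  thus "j \<in> (\<lambda>i. Suc i mod p) ` colour_parts p r f c X"
    using j part_rot[OF assms i(1)] by (auto simp: colour_parts_def)
next
  fix j assume "j \<in> (\<lambda>i. Suc i mod p) ` colour_parts p r f c X"
  then obtain i where i: "i \<in> colour_parts p r f c X" "j = Suc i mod p" by blast
  hence "i < p" by (simp add: colour_parts_def)
  thus "j \<in> colour_parts p r f c (rot p X)"
    using i part_rot[OF assms \<open>i < p\<close>] by (simp add: colour_parts_def)
qed

lemma colour_parts_mono: "X \<subseteq> Y \<Longrightarrow> colour_parts p r f c X \<subseteq> colour_parts p r f c Y"
proof -
  assume "X \<subseteq> Y"
  hence "part X i \<subseteq> part Y i" for i by (auto simp: part_def)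
  thus ?thesis
    unfolding colour_parts_def using nsets_mono by blast
qed

lemma finite_colour_parts: "finite (colour_parts p r f c X)"
  by (rule finite_subset[of _ "{..<p}"]) (auto simp: colour_parts_def)

text \<open>Sets chosen from different parts are disjoint, as \<open>X\<close> gives each point only
  one sign; since \<open>r \<ge> 1\<close> they are nonempty and hence distinct.\<close>

lemma colour_parts_full:
  assumes "sign_vector p n X" "r \<ge> 1" "colour_parts p r f c X = {..<p}"
  shows "has_matching {..<n} r f c p"
proof -
  have "\<forall>i \<in> {..<p}. \<exists>F. F \<in> nsets (part X i) r \<and> f F = c"
    using assms(3) by (auto simp: colour_parts_def)
  then obtain F where F: "F i \<in> nsets (part X i) r" "f (F i) = c" if "i < p" for i
    by (metis lessThan_iff)
  have disj: "F i \<inter> F j = {}" if "i < p" "j < p" "i \<noteq> j" for i j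
  proof -
    have "part X i \<inter> part X j = {}"
      using assms(1) that by (auto simp: part_def sign_vector_def single_valued_def)
    thus ?thesis using F(1)[OF that(1)] F(1)[OF that(2)] by (auto simp: nsets_def)
  qed
  have "F i \<noteq> {}" if "i < p" for i
    using F(1)[OF that] assms(2) by (auto simp: nsets_def)
  hence "inj_on F {..<p}"
    using disj by (intro inj_onI) (metis inf.idem lessThan_iff)
  hence "card (F ` {..<p}) = p"
    by (simp add: card_image)
  moreover have "pairwise disjnt (F ` {..<p})"
    using disj by (auto simp: pairwise_def disjnt_def)
  moreover have "part X i \<subseteq> {..<n}" for i
    using assms(1) by (auto simp: part_def sign_vector_def)
  hence "F ` {..<p} \<subseteq> nsets {..<n} r"
    using F(1) nsets_mono by blast
  ultimately show ?thesis
    unfolding has_matching_def using F(2) by (intro exI[of _ "F ` {..<p}"]) auto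
qed

lemma sum_rot:
  assumes "S \<subseteq> {..<p}"
  shows "[(\<Sum>i \<in> (\<lambda>i. Suc i mod p) ` S. int i) = (\<Sum>i \<in> S. int i) + int (card S)] (mod int p)"
proof -
  have "(\<Sum>i \<in> (\<lambda>i. Suc i mod p) ` S. int i) = (\<Sum>i \<in> S. int (Suc i mod p))"
    using inj_on_subset[OF inj_on_Suc_mod assms] by (simp add: sum.reindex)
  also have "[\<dots> = (\<Sum>i \<in> S. int i + 1)] (mod int p)"
    by (intro cong_sum) (simp add: cong_def zmod_int add.commute)
  also have "(\<Sum>i \<in> S. int i + 1) = (\<Sum>i \<in> S. int i) + int (card S)"
    by (simp add: sum.distrib)
  finally show ?thesis .
qed

lemma card_sign_vector_le:
  assumes "sign_vector p n X" "\<And>i. i < p \<Longrightarrow> card (part X i) \<le> b"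
  shows "card X \<le> p * b"
proof -
  have "X = (\<Union>i<p. (\<lambda>x. (x, i)) ` part X i)"
    using assms(1) by (auto simp: sign_vector_def part_def)
  hence "card X = card (\<Union>i<p. (\<lambda>x. (x, i)) ` part X i)"
    by (rule arg_cong)
  also have "\<dots> \<le> (\<Sum>i<p. card ((\<lambda>x. (x, i)) ` part X i))"
    by (rule card_UN_le) simp
  also have "\<dots> \<le> (\<Sum>i<p. b)"
  proof (rule sum_mono)
    fix i assume "i \<in> {..<p}"
    moreover have "finite (part X i)"
      by (rule finite_subset[of _ "{..<n}"]) (use assms(1) in \<open>auto simp: part_def sign_vector_def\<close>)
    ultimately show "card ((\<lambda>x. (x, i)) ` part X i) \<le> b"
      using assms(2) by (intro le_trans[OF card_image_le]) simp_all
  qed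
  finally show ?thesis by simp
qed

section \<open>Matchings of prime size\<close>

text \<open>Without a matching, the Z_p-Tucker lemma applies to this level: the cardinality of
  \<open>X\<close> while no part contains an \<open>r\<close>-set, at most
  \<open>p * (r - 1)\<close>, and afterwards that offset plus the number of pairs of a colour and a
  sign that occur.\<close>

lemma kneser_hypergraph_prime:
  fixes f :: "nat set \<Rightarrow> nat"
  assumes "prime p" "r \<ge> 1" "t \<ge> 1" and n: "n = p * r + (t - 1) * (p - 1)"
    and f: "\<And>F. F \<in> nsets {..<n} r \<Longrightarrow> f F < t"
  shows "\<exists>c<t. has_matching {..<n} r f c p"
proof (rule ccontr)
  assume neg: "\<not> ?thesis"
  have p: "p \<ge> 2" using assms(1) by (rule prime_ge_2_nat)
  define S where "S c X = colour_parts p r f c X" for c X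
  define small where "small X \<longleftrightarrow> (\<forall>c<t. S c X = {})" for X
  \<comment> \<open>The colour classes \<open>S c X\<close> are proper subsets of \<open>Z\<^sub>p\<close>, so each colour contributes at most \<open>p - 1\<close>
    levels; dividing the sum of a class by its cardinality modulo \<open>p\<close> gives an equivariant sign.\<close>
  define level where
    "level X = (if small X then card X else p * (r - 1) + (\<Sum>c<t. card (S c X)))" for X
  define first where "first X = (LEAST c. c < t \<and> S c X \<noteq> {})" for X
  define recip where "recip a = (SOME u. [u * int a = 1] (mod int p))" for a
  \<comment> \<open>On small vectors the sign of the least point of the support is already
    equivariant.\<close>
  define s where
    "s X = (if small X then int (THE i. (Min (fst ` X), i) \<in> X)
            else recip (card (S (first X) X)) * (\<Sum>i \<in> S (first X) X. int i))" for X
  have S_sub: "S c X \<subseteq> {..<p}" for c X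
    by (auto simp: S_def colour_parts_def)
  have fin_S: "finite (S c X)" for c X
    unfolding S_def by (rule finite_colour_parts)
  have S_mono: "S c X \<subseteq> S c Y" if "X \<subseteq> Y" for c X Y
    unfolding S_def using that by (rule colour_parts_mono)
  have S_rot: "S c (rot p X) = (\<lambda>i. Suc i mod p) ` S c X" if "sign_vector p n X" for c X
    unfolding S_def using that by (rule colour_parts_rot)
  have small_mono: "small X" if "small Y" "X \<subseteq> Y" for X Y
    using that S_mono[of X Y] unfolding small_def by blast
  have card_S: "card (S c X) \<le> p - 1" if "sign_vector p n X" "c < t" for c X
  proof -
    have "S c X \<noteq> {..<p}"
      using colour_parts_full[OF that(1) assms(2)] neg that(2) unfolding S_def by blast
    hence "S c X \<subset> {..<p}" using S_sub by blast
    hence "card (S c X) < card {..<p}" by (intro psubset_card_mono) simp_all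
    thus ?thesis by simp
  qed
  have fin: "finite X" if "sign_vector p n X" for X
    by (rule finite_subset[of X "{..<n} \<times> {..<p}"]) (use that in \<open>simp_all add: sign_vector_def\<close>)
  have small_card: "card X \<le> p * (r - 1)" if X: "sign_vector p n X" "small X" for X
    using X(1)
  proof (rule card_sign_vector_le)
    fix i assume i: "i < p"
    show "card (part X i) \<le> r - 1"
    proof (rule ccontr)
      assume "\<not> ?thesis"
      hence "r \<le> card (part X i)" by simp
      then obtain F where F: "F \<subseteq> part X i" "card F = r" "finite F"
        by (rule obtain_subset_with_card_n)
      have "part X i \<subseteq> {..<n}"
        using X(1) by (auto simp: part_def sign_vector_def)
      hence "f F < t" using F by (intro f) (auto simp: nsets_def)
      moreover have "i \<in> S (f F) X"
        using F i by (auto simp: S_def colour_parts_def nsets_def)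
      ultimately show False using X(2) by (auto simp: small_def)
    qed
  qed
  have first: "first X < t \<and> S (first X) X \<noteq> {}" if "\<not> small X" for X
    unfolding first_def by (rule LeastI_ex) (use that in \<open>auto simp: small_def\<close>)
  have big: "p * (r - 1) < level X" if "\<not> small X" for X
  proof -
    have "0 < card (S (first X) X)"
      using first[OF that] fin_S by (simp add: card_gt_0_iff)
    also have "\<dots> \<le> (\<Sum>c<t. card (S c X))"
      using first[OF that] by (intro member_le_sum) simp_all
    finally show ?thesis using that by (simp add: level_def)
  qed
  show False
  proof (rule zp_tucker[of p n s level])
    show "n \<ge> 1" using p assms(2) n by (simp add: Suc_le_eq)
  next
    fix X assume X: "sign_vector p n X"
    have ge: "1 \<le> level X"
    proof (cases "small X")
      case True
      thus ?thesis
        using fin[OF X] X by (simp add: level_def Suc_le_eq card_gt_0_iff sign_vector_def)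
    qed (use big in fastforce)
    have "level X \<le> p * (r - 1) + t * (p - 1)"
    proof (cases "small X")
      case True
      thus ?thesis using small_card[OF X] by (simp add: level_def)
    next
      case False
      have "(\<Sum>c<t. card (S c X)) \<le> (\<Sum>c<t. p - 1)"
        using card_S[OF X] by (intro sum_mono) simp
      thus ?thesis using False by (simp add: level_def)
    qed
    \<comment> \<open>In fact \<open>p * (r - 1) + t * (p - 1) = n - 1\<close>, so the levels just
      fit.\<close>
    also have "\<dots> < n"
    proof -
      obtain p' r' t' where "p = Suc p'" "r = Suc r'" "t = Suc t'"
        using p assms(2,3) by (metis Suc_le_D One_nat_def numeral_2_eq_2)
      thus ?thesis unfolding n by (simp add: algebra_simps)
    qed
    finally show "1 \<le> level X \<and> level X < n" using ge by simp
  next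
    fix X assume X: "sign_vector p n X"
    have small_rot: "small (rot p X) \<longleftrightarrow> small X"
      unfolding small_def S_rot[OF X] by simp
    show "[s (rot p X) = s X + 1] (mod int p)"
    proof (cases "small X")
      case True
      define m where "m = Min (fst ` X)"
      have "m \<in> fst ` X"
        unfolding m_def using X fin[OF X] by (intro Min_in) (auto simp: sign_vector_def)
      then obtain i where i: "(m, i) \<in> X" by auto
      have "(THE i. (m, i) \<in> X) = i"
        using X i by (intro the_equality) (auto simp: sign_vector_def single_valued_def)
      moreover have "fst ` rot p X = fst ` X"
        unfolding rot_def image_image by simp
      moreover have "(m, Suc i mod p) \<in> rot p X"
        unfolding rot_def using i by force
      hence "(THE i. (m, i) \<in> rot p X) = Suc i mod p"
        using sign_vector_rot[OF X] by (intro the_equality) (auto simp: sign_vector_def single_valued_def)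
      ultimately show ?thesis
        using True by (simp add: s_def small_rot m_def cong_def zmod_int add.commute)
    next
      case False
      define A where "A = S (first X) X"
      have "first (rot p X) = first X"
        unfolding first_def S_rot[OF X] by simp
      hence A': "S (first (rot p X)) (rot p X) = (\<lambda>i. Suc i mod p) ` A"
        by (simp add: S_rot[OF X] A_def)
      have card: "card ((\<lambda>i. Suc i mod p) ` A) = card A"
        using S_sub by (intro card_image inj_on_subset[OF inj_on_Suc_mod]) (simp add: A_def)
      have "0 < card A" "card A < p"
        using first[OF False] fin_S card_S[OF X, of "first X"] p by (auto simp: A_def card_gt_0_iff)
      \<comment> \<open>The class is nonempty and proper, so primality makes its cardinality
        invertible modulo \<open>p\<close>.\<close>
      hence "\<not> p dvd card A" by (auto dest: dvd_imp_le)
      hence "coprime (int (card A)) (int p)"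
        using assms(1) by (simp add: coprime_commute prime_imp_coprime)
      hence "\<exists>u. [u * int (card A) = 1] (mod int p)"
        using cong_solve_coprime_int[of "int (card A)" "int p"] by (auto simp: mult.commute)
      hence recip: "[recip (card A) * int (card A) = 1] (mod int p)"
        unfolding recip_def by (rule someI_ex)
      have "s (rot p X) = recip (card A) * (\<Sum>i \<in> (\<lambda>i. Suc i mod p) ` A. int i)"
        using False unfolding s_def small_rot A' card by simp
      also have "[\<dots> = recip (card A) * ((\<Sum>i \<in> A. int i) + int (card A))] (mod int p)"
        using S_sub by (intro cong_scalar_left sum_rot) (simp add: A_def)
      also have "recip (card A) * ((\<Sum>i \<in> A. int i) + int (card A))
               = s X + recip (card A) * int (card A)"
        using False by (simp add: s_def A_def distrib_left)
      also have "[\<dots> = s X + 1] (mod int p)"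
        using recip by (intro cong_add cong_refl)
      finally show ?thesis .
    qed
  next
    fix X Y assume XY: "sign_vector p n X" "sign_vector p n Y" "X \<subset> Y"
    consider "small X" "small Y" | "small X" "\<not> small Y" | "\<not> small X" "\<not> small Y"
      using small_mono[of Y X] XY(3) by blast
    thus "level X \<le> level Y"
    proof cases
      case 1
      thus ?thesis
        using XY(3) fin[OF XY(2)] by (simp add: level_def card_mono psubset_imp_subset)
    next
      case 2
      thus ?thesis
        using small_card[OF XY(1) 2(1)] big[OF 2(2)] by (simp add: level_def)
    next
      case 3
      thus ?thesis
        using S_mono[of X Y] XY(3) fin_S
        by (auto simp: level_def intro!: sum_mono card_mono)
    qed
  next
    fix X Y assume XY: "sign_vector p n X" "sign_vector p n Y" "X \<subset> Y" "level X = level Y"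
    consider "small X" "small Y" | "small X" "\<not> small Y" | "\<not> small X" "\<not> small Y"
      using small_mono[of Y X] XY(3) by blast
    thus "s X = s Y"
    proof cases
      case 1
      thus ?thesis
        using XY(4) psubset_card_mono[OF fin[OF XY(2)] XY(3)] by (simp add: level_def)
    next
      case 2
      thus ?thesis
        using small_card[OF XY(1) 2(1)] big[OF 2(2)] XY(4) by (simp add: level_def)
    next
      case 3
      have sub: "S c X \<subseteq> S c Y" for c
        using S_mono[of X Y] XY(3) by blast
      have sums: "(\<Sum>c<t. card (S c X)) = (\<Sum>c<t. card (S c Y))"
        using XY(4) 3 by (simp add: level_def)
      \<comment> \<open>Nested classes with equal total cardinality agree colour by colour.\<close>
      have eq: "S c X = S c Y" if "c < t" for c
      proof -
        have "card (S c X) = card (S c Y)"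
          using sums sub fin_S that
          by (intro sum_mono_inv[of "\<lambda>c. card (S c X)" "{..<t}" "\<lambda>c. card (S c Y)"])
             (simp_all add: card_mono)
        thus ?thesis using sub fin_S by (intro card_subset_eq)
      qed
      have "first X = first Y"
        unfolding first_def using eq by (metis (no_types, lifting))
      moreover have "S (first X) X = S (first X) Y"
        using first[OF 3(1)] by (intro eq) simp
      ultimately show ?thesis
        using 3 by (simp add: s_def)
    qed
  qed (use p in simp)
qed

section \<open>Matchings of arbitrary size\<close>

lemma has_matching_image:
  assumes "inj_on g U" "has_matching U r (\<lambda>F. f (g ` F)) c k"
  shows "has_matching (g ` U) r f c k"
proof -
  obtain M where M: "M \<subseteq> nsets U r" "finite M" "card M = k" "pairwise disjnt M"
    "\<forall>F \<in> M. f (g ` F) = c"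
    using assms(2) unfolding has_matching_def by blast
  have sub: "F \<subseteq> U" if "F \<in> M" for F
    using M(1) that by (auto simp: nsets_def)
  have "inj_on ((`) g) M"
    using inj_on_nsets[OF assms(1)] M(1) by (rule inj_on_subset)
  hence "card ((`) g ` M) = k"
    using M(3) by (simp add: card_image)
  moreover have "(`) g ` M \<subseteq> nsets (g ` U) r"
    using M(1) inj_on_subset[OF assms(1)] by (auto simp: nsets_def card_image)
  moreover have "pairwise disjnt ((`) g ` M)"
  proof (rule pairwiseI)
    fix A B assume AB: "A \<in> (`) g ` M" "B \<in> (`) g ` M" "A \<noteq> B"
    then obtain F G where FG: "F \<in> M" "G \<in> M" "A = g ` F" "B = g ` G" by blast
    hence "F \<inter> G = {}" using M(4) AB(3) by (auto simp: pairwise_def disjnt_def)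
    thus "disjnt A B"
      using inj_on_image_Int[OF assms(1) sub[OF FG(1)] sub[OF FG(2)]] FG by (simp add: disjnt_def)
  qed
  ultimately show ?thesis
    unfolding has_matching_def using M(2,5) by (intro exI[of _ "(`) g ` M"]) simp
qed

lemma kneser_hypergraph_prime_card:
  fixes f :: "'a set \<Rightarrow> nat"
  assumes "prime p" "r \<ge> 1" "t \<ge> 1" "p * r + (t - 1) * (p - 1) \<le> card V"
    and f: "\<And>F. F \<in> nsets V r \<Longrightarrow> f F < t"
  shows "\<exists>c<t. has_matching V r f c p"
proof -
  define n where "n = p * r + (t - 1) * (p - 1)"
  obtain W where W: "W \<subseteq> V" "card W = n" "finite W"
    using assms(4) unfolding n_def by (rule obtain_subset_with_card_n)
  then obtain g where g: "bij_betw g {..<n} W"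
    using ex_bij_betw_nat_finite[of W] by (auto simp: atLeast0LessThan)
  have inj: "inj_on g {..<n}" and img: "g ` {..<n} = W"
    using g by (simp_all add: bij_betw_def)
  have "f (g ` F) < t" if "F \<in> nsets {..<n} r" for F
  proof (rule f)
    have "g ` F \<in> nsets W r"
      using bij_betw_apply[OF bij_betw_nsets[OF g] that] .
    thus "g ` F \<in> nsets V r" using nsets_mono[OF W(1)] by blast
  qed
  then obtain c where "c < t" "has_matching {..<n} r (\<lambda>F. f (g ` F)) c p"
    using kneser_hypergraph_prime[OF assms(1-3) n_def, of "\<lambda>F. f (g ` F)"] by blast
  thus ?thesis
    using has_matching_image[OF inj] has_matching_mono[OF _ W(1)] img by metis
qed

text \<open>Multiplies matching sizes: matchings inside disjoint \<open>q\<close>-sets are disjoint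
  from each other, and \<open>r \<ge> 1\<close> keeps their members distinct, so that the sizes add
  up.\<close>

lemma has_matching_compose:
  assumes "has_matching V q g c a" "r \<ge> 1"
    and "\<And>Y. Y \<in> nsets V q \<Longrightarrow> g Y = c \<Longrightarrow> has_matching Y r f c b"
  shows "has_matching V r f c (a * b)"
proof -
  obtain M where M: "M \<subseteq> nsets V q" "finite M" "card M = a" "pairwise disjnt M" "\<forall>Y \<in> M. g Y = c"
    using assms(1) unfolding has_matching_def by blast
  have "\<forall>Y \<in> M. \<exists>N. N \<subseteq> nsets Y r \<and> finite N \<and> card N = b \<and> pairwise disjnt N \<and> (\<forall>F \<in> N. f F = c)"
    using assms(3) M(1,5) unfolding has_matching_def by blast
  then obtain N where N: "\<And>Y. Y \<in> M \<Longrightarrow> N Y \<subseteq> nsets Y r" "\<And>Y. Y \<in> M \<Longrightarrow> finite (N Y)"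
    "\<And>Y. Y \<in> M \<Longrightarrow> card (N Y) = b" "\<And>Y. Y \<in> M \<Longrightarrow> pairwise disjnt (N Y)"
    "\<And>Y F. Y \<in> M \<Longrightarrow> F \<in> N Y \<Longrightarrow> f F = c"
    by metis
  have disj: "F \<inter> G = {}" if "Y \<in> M" "Z \<in> M" "Y \<noteq> Z" "F \<in> N Y" "G \<in> N Z" for Y Z F G
  proof -
    have "F \<subseteq> Y" "G \<subseteq> Z"
      using N(1)[OF that(1)] N(1)[OF that(2)] that(4,5) by (auto simp: nsets_def)
    moreover have "Y \<inter> Z = {}"
      using M(4) that(1-3) by (simp add: pairwise_def disjnt_def)
    ultimately show ?thesis by blast
  qed
  have nonempty: "F \<noteq> {}" if "Y \<in> M" "F \<in> N Y" for Y F
    using N(1)[OF that(1)] that(2) assms(2) by (auto simp: nsets_def)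
  have "card (\<Union>Y \<in> M. N Y) = (\<Sum>Y \<in> M. card (N Y))"
  proof (rule card_UN_disjoint)
    show "\<forall>Y \<in> M. \<forall>Z \<in> M. Y \<noteq> Z \<longrightarrow> N Y \<inter> N Z = {}"
      using disj nonempty by (metis Int_emptyI inf.idem)
  qed (use M(2) N(2) in auto)
  hence "card (\<Union>Y \<in> M. N Y) = a * b"
    using N(3) M(3) by simp
  moreover have "(\<Union>Y \<in> M. N Y) \<subseteq> nsets V r"
  proof -
    have "nsets Y r \<subseteq> nsets V r" if "Y \<in> M" for Y
      using M(1) that by (intro nsets_mono) (auto simp: nsets_def)
    thus ?thesis using N(1) by blast
  qed
  moreover have "pairwise disjnt (\<Union>Y \<in> M. N Y)"
  proof (rule pairwiseI)
    fix F G assume FG: "F \<in> (\<Union>Y \<in> M. N Y)" "G \<in> (\<Union>Y \<in> M. N Y)" "F \<noteq> G"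
    then obtain Y Z where YZ: "Y \<in> M" "Z \<in> M" "F \<in> N Y" "G \<in> N Z" by blast
    show "disjnt F G"
    proof (cases "Y = Z")
      case True
      thus ?thesis using N(4)[OF YZ(1)] YZ FG(3) by (simp add: pairwise_def)
    qed (use disj YZ in \<open>simp add: disjnt_def\<close>)
  qed
  ultimately show ?thesis
    unfolding has_matching_def using M(2) N(2,5) by (intro exI[of _ "\<Union>Y \<in> M. N Y"]) auto
qed

text \<open>Induction along \<open>k = p * b\<close>: every set of the size required for
  \<open>b\<close> contains a matching of size \<open>b\<close>, whose colour defines a colouring of
  these larger sets; the prime case applies to it.\<close>

theorem kneser_hypergraph:
  fixes f :: "'a set \<Rightarrow> nat"
  assumes "k \<ge> 1" "r \<ge> 1" "t \<ge> 1" "k * r + (t - 1) * (k - 1) \<le> card V"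
    and f: "\<And>F. F \<in> nsets V r \<Longrightarrow> f F < t"
  shows "\<exists>c<t. has_matching V r f c k"
  using assms(1,4) f
proof (induction k arbitrary: V rule: less_induct)
  case (less k)
  show ?case
  proof (cases "k = 1")
    case True
    hence "r \<le> card V" using less.prems(2) by simp
    then obtain F where F: "F \<subseteq> V" "card F = r" "finite F"
      by (rule obtain_subset_with_card_n)
    hence "F \<in> nsets V r" by (simp add: nsets_def)
    moreover from this have "has_matching V r f (f F) k"
      unfolding has_matching_def using True by (intro exI[of _ "{F}"]) simp
    ultimately show ?thesis using less.prems(3) by blast
  next
    case False
    then obtain p where p: "prime p" "p dvd k" using prime_factor_nat by blast
    then obtain b where b: "k = p * b" by (elim dvdE)
    have "p \<ge> 2" using p(1) by (rule prime_ge_2_nat)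
    have "b \<ge> 1" using b less.prems(1) by (cases b) simp_all
    hence "b < k" using b \<open>p \<ge> 2\<close> by simp
    define q where "q = b * r + (t - 1) * (b - 1)"
    have "q \<ge> 1" using \<open>b \<ge> 1\<close> assms(2) by (simp add: q_def Suc_le_eq)
    have *: "\<exists>c. c < t \<and> has_matching Y r f c b" if Y: "Y \<in> nsets V q" for Y
    proof -
      have "nsets Y r \<subseteq> nsets V r"
        using Y by (intro nsets_mono) (simp add: nsets_def)
      thus ?thesis
        using Y by (intro less.IH \<open>b < k\<close> \<open>b \<ge> 1\<close> less.prems(3)) (auto simp: nsets_def q_def)
    qed
    define g where "g Y = (SOME c. c < t \<and> has_matching Y r f c b)" for Y
    have g: "g Y < t \<and> has_matching Y r f (g Y) b" if "Y \<in> nsets V q" for Y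
      unfolding g_def using *[OF that] by (rule someI_ex)
    \<comment> \<open>The thresholds for \<open>b\<close> and for \<open>p\<close> compose without
      loss.\<close>
    have "p * q + (t - 1) * (p - 1) = k * r + (t - 1) * (k - 1)"
    proof -
      obtain p' b' t' where "p = Suc p'" "b = Suc b'" "t = Suc t'"
        using \<open>p \<ge> 2\<close> \<open>b \<ge> 1\<close> assms(3) by (cases p; cases b; cases t) simp_all
      thus ?thesis unfolding q_def b by (simp add: algebra_simps)
    qed
    then obtain c where "c < t" "has_matching V q g c p"
      using kneser_hypergraph_prime_card[OF p(1) \<open>q \<ge> 1\<close> assms(3), of V g] g less.prems(2) by auto
    moreover from this have "has_matching V r f c k"
      unfolding b using g by (intro has_matching_compose[OF _ assms(2)]) auto
    ultimately show ?thesis by blast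
  qed
qed

section \<open>Unequal matching sizes\<close>

text \<open>Colour \<open>c\<close> receives \<open>K - k c\<close> extra points, and a set that
  meets the extra points takes the colour of one that it contains. In a matching of size
  \<open>K\<close> in colour \<open>c\<close>, at most \<open>K - k c\<close> members use such
  points, so at least \<open>k c\<close> members lie in \<open>V\<close>.\<close>

theorem kneser_hypergraph_unequal:
  fixes f :: "'a set \<Rightarrow> nat" and k :: "nat \<Rightarrow> nat"
  assumes "K \<ge> 1" "r \<ge> 1" "t \<ge> 1" "finite V"
    and k: "\<And>c. c < t \<Longrightarrow> 1 \<le> k c \<and> k c \<le> K"
    and n: "r * K + (\<Sum>c<t. k c - 1) \<le> card V + (K - 1)"
    and f: "\<And>F. F \<in> nsets V r \<Longrightarrow> f F < t"
  shows "\<exists>c<t. has_matching V r f c (k c)"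
proof -
  define P where "P = (SIGMA c:{..<t}. {..<K - k c})"
  define V' :: "('a + nat \<times> nat) set" where "V' = Inl ` V \<union> Inr ` P"
  define h where
    "h F = (if F \<subseteq> range Inl then f (Inl -` F) else SOME c. c < t \<and> (\<exists>j<K - k c. Inr (c, j) \<in> F))"
    for F :: "('a + nat \<times> nat) set"
  have Inl_vimage: "Inl -` F \<in> nsets V r" if "F \<in> nsets V' r" "F \<subseteq> range Inl" for F
  proof -
    have "F = Inl ` (Inl -` F)" using that(2) by auto
    hence "card (Inl -` F) = card F" "finite (Inl -` F) = finite F"
      by (metis card_image finite_image_iff inj_Inl inj_on_subset subset_UNIV)+
    thus ?thesis
      using that(1) by (auto simp: nsets_def V'_def)
  qed
  have Inr_ex: "h F < t \<and> (\<exists>j<K - k (h F). Inr (h F, j) \<in> F)"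
    if F: "F \<in> nsets V' r" "\<not> F \<subseteq> range Inl" for F
  proof -
    have "\<exists>c. c < t \<and> (\<exists>j<K - k c. Inr (c, j) \<in> F)"
      using F by (auto simp: nsets_def V'_def P_def)
    from someI_ex[OF this] show ?thesis using F(2) by (simp add: h_def)
  qed
  have "card V' = card V + card P"
  proof -
    have "finite P" by (simp add: P_def)
    thus ?thesis
      unfolding V'_def using assms(4)
      by (subst card_Un_disjoint) (auto simp: card_image)
  qed
  moreover have "card P = (\<Sum>c<t. K - k c)"
    by (simp add: P_def)
  moreover have "(\<Sum>c<t. K - k c) + (\<Sum>c<t. k c - 1) = (\<Sum>c<t. K - 1)"
    unfolding sum.distrib[symmetric] using k by (intro sum.cong) auto
  hence "(\<Sum>c<t. K - k c) + (\<Sum>c<t. k c - 1) = (t - 1) * (K - 1) + (K - 1)"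
    using assms(3) by (cases t) simp_all
  ultimately have "K * r + (t - 1) * (K - 1) \<le> card V'"
    using n by (simp add: mult.commute)
  moreover have "h F < t" if "F \<in> nsets V' r" for F
    using Inr_ex[OF that] f[OF Inl_vimage[OF that]] by (auto simp: h_def)
  ultimately obtain c where c: "c < t" "has_matching V' r h c K"
    using kneser_hypergraph[OF assms(1-3), of V' h] by blast
  then obtain M where M: "M \<subseteq> nsets V' r" "finite M" "card M = K" "pairwise disjnt M" "\<forall>F \<in> M. h F = c"
    unfolding has_matching_def by blast
  define M1 M2 where "M1 = {F \<in> M. F \<subseteq> range Inl}" and "M2 = {F \<in> M. \<not> F \<subseteq> range Inl}"
  have "\<exists>j. j < K - k c \<and> Inr (c, j) \<in> F" if F: "F \<in> M2" for F
  proof -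
    have "F \<in> nsets V' r" "\<not> F \<subseteq> range Inl" "h F = c"
      using F M(1,5) by (auto simp: M2_def)
    thus ?thesis using Inr_ex[of F] by blast
  qed
  hence "\<exists>j. \<forall>F \<in> M2. j F < K - k c \<and> Inr (c, j F) \<in> F"
    by (intro bchoice ballI)
  then obtain j where j: "\<And>F. F \<in> M2 \<Longrightarrow> j F < K - k c" "\<And>F. F \<in> M2 \<Longrightarrow> Inr (c, j F) \<in> F"
    by blast
  \<comment> \<open>The chosen extra points all have colour \<open>c\<close>, so equal indices mean
    a common point, which disjoint members cannot have.\<close>
  have "inj_on j M2"
  proof (rule inj_onI)
    fix F G assume FG: "F \<in> M2" "G \<in> M2" "j F = j G"
    hence "F \<inter> G \<noteq> {}" using j(2)[of F] j(2)[of G] by auto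
    thus "F = G" using M(4) FG(1,2) unfolding M2_def pairwise_def disjnt_def by blast
  qed
  hence "card M2 \<le> card {..<K - k c}"
    using j(1) by (intro card_inj_on_le) auto
  moreover have "card M1 + card M2 = K"
  proof -
    have "M1 \<union> M2 = M" "M1 \<inter> M2 = {}" "finite M1" "finite M2"
      using M(2) by (auto simp: M1_def M2_def)
    thus ?thesis using M(3) card_Un_disjoint[of M1 M2] by simp
  qed
  ultimately have M1: "K - card {..<K - k c} \<le> card M1" by linarith
  have "k c \<le> card M1"
    using k[OF c(1)] M1 by (simp add: diff_diff_cancel)
  then obtain N where N: "N \<subseteq> M1" "card N = k c" "finite N"
    by (rule obtain_subset_with_card_n)
  have range: "F \<subseteq> range Inl" "F \<in> M" if "F \<in> N" for F
    using N(1) that by (auto simp: M1_def)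
  have "inj_on ((-`) Inl) N"
  proof (rule inj_onI)
    fix F G :: "('a + nat \<times> nat) set"
    assume "F \<in> N" "G \<in> N" "Inl -` F = Inl -` G"
    thus "F = G" using range(1)[of F] range(1)[of G] by blast
  qed
  hence "card ((-`) Inl ` N) = k c" using N(2) by (simp add: card_image)
  moreover have "(-`) Inl ` N \<subseteq> nsets V r"
    using Inl_vimage range M(1) by blast
  moreover have "pairwise disjnt ((-`) Inl ` N)"
  proof (rule pairwiseI)
    fix A B assume AB: "A \<in> (-`) Inl ` N" "B \<in> (-`) Inl ` N" "A \<noteq> B"
    then obtain F G where FG: "F \<in> N" "G \<in> N" "A = Inl -` F" "B = Inl -` G" by blast
    hence "F \<inter> G = {}"
      using AB(3) M(4) range(2)[of F] range(2)[of G] by (auto simp: pairwise_def disjnt_def)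
    thus "disjnt A B" using FG by (auto simp: disjnt_def)
  qed
  moreover have "f A = c" if A: "A \<in> (-`) Inl ` N" for A
  proof -
    obtain F where F: "F \<in> N" "A = Inl -` F" using A by blast
    hence "h F = c" using range(2) M(5) by blast
    thus ?thesis using range(1)[OF F(1)] F(2) by (simp add: h_def)
  qed
  ultimately have "has_matching V r f c (k c)"
    unfolding has_matching_def using N(3) by (intro exI[of _ "(-`) Inl ` N"]) simp
  thus ?thesis using c(1) by blast
qed

section \<open>Ramsey numbers\<close>

lemma partn_lst_ramsey_number: "partn_lst {..<ramsey_number a b} [a, b] 2"
  unfolding ramsey_number_def by (rule LeastI_ex) (rule ramsey_full)

lemma ramsey_number_clique:
  fixes g :: "'a set \<Rightarrow> nat"
  assumes M: "finite M" "card M = ramsey_number a b"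
    and g: "\<And>e. e \<in> nsets M 2 \<Longrightarrow> g e < 2"
  shows "(\<exists>H \<in> nsets M a. \<forall>e \<in> nsets H 2. g e = 0) \<or> (\<exists>H \<in> nsets M b. \<forall>e \<in> nsets H 2. g e = 1)"
proof -
  define n where "n = ramsey_number a b"
  obtain h where h: "bij_betw h {..<n} M"
    using ex_bij_betw_nat_finite[OF M(1)] M(2) by (auto simp: n_def atLeast0LessThan)
  have "g (h ` e) < 2" if "e \<in> nsets {..<n} 2" for e
    using bij_betw_apply[OF bij_betw_nsets[OF h] that] by (rule g)
  hence "(\<lambda>e. g (h ` e)) \<in> nsets {..<n} 2 \<rightarrow> {..<length [a, b]}"
    by (simp add: Pi_def numeral_2_eq_2)
  hence "\<exists>i < length [a, b]. monochromatic {..<n} ([a, b] ! i) 2 (\<lambda>e. g (h ` e)) i"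
    using partn_lst_ramsey_number[of a b] unfolding partn_lst_def n_def by (rule bspec[rotated])
  hence "\<exists>i < 2. monochromatic {..<n} ([a, b] ! i) 2 (\<lambda>e. g (h ` e)) i"
    by (simp add: numeral_2_eq_2)
  then obtain i H where i: "i < 2" "H \<in> nsets {..<n} ([a, b] ! i)"
    and H: "(\<lambda>e. g (h ` e)) ` nsets H 2 \<subseteq> {i}"
    unfolding monochromatic_def by blast
  have "h ` H \<in> nsets M ([a, b] ! i)"
    using bij_betw_apply[OF bij_betw_nsets[OF h] i(2)] .
  moreover have "g e = i" if e: "e \<in> nsets (h ` H) 2" for e
  proof -
    have "inj_on h H"
      using h i(2) by (auto simp: bij_betw_def nsets_def intro: inj_on_subset)
    then obtain e' where "e' \<in> nsets H 2" "e = h ` e'"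
      using nset_image_obtains[OF e] by blast
    thus ?thesis using H by blast
  qed
  ultimately have "\<exists>H' \<in> nsets M ([a, b] ! i). \<forall>e \<in> nsets H' 2. g e = i"
    by blast
  moreover have "i = 0 \<or> i = 1" using i(1) by auto
  ultimately show ?thesis by auto
qed

text \<open>Colour every edge 1: a clique of colour 0 on \<open>a \<ge> 2\<close> vertices would
  contain an edge, so the clique found has size \<open>b\<close>.\<close>

lemma ramsey_number_ge:
  assumes "a \<ge> 2"
  shows "b \<le> ramsey_number a b"
proof -
  define n where "n = ramsey_number a b"
  have "(\<exists>H \<in> nsets {..<n} a. \<forall>e \<in> nsets H 2. (1::nat) = 0) \<or>
        (\<exists>H \<in> nsets {..<n} b. \<forall>e \<in> nsets H 2. (1::nat) = 1)"
    using ramsey_number_clique[of "{..<n}" a b "\<lambda>_. 1"] by (simp add: n_def)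
  moreover have "nsets H 2 \<noteq> {}" if "H \<in> nsets {..<n} a" for H
    unfolding nsets_eq_empty_iff using that assms by (simp add: nsets_def)
  ultimately have "nsets {..<n} b \<noteq> {}" by force
  then obtain H where "H \<in> nsets {..<n} b" by blast
  hence "card H \<le> card {..<n}" "card H = b"
    using card_mono[of "{..<n}" H] by (simp_all add: nsets_def)
  thus ?thesis by (simp add: n_def)
qed

lemma ramsey_number_mono_right:
  assumes "b \<le> b'"
  shows "ramsey_number a b \<le> ramsey_number a b'"
proof -
  have "partn_lst {..<ramsey_number a b'} [a, b] 2"
    using partn_lst_ramsey_number
  proof (rule partn_lst_less)
    fix i assume "i < length [a, b']"
    thus "[a, b] ! i \<le> [a, b'] ! i"
      using assms by (cases i) simp_all
  qed simp
  thus ?thesis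
    unfolding ramsey_number_def[of a b] by (rule Least_le)
qed

section \<open>The bound for Kneser Ramsey numbers\<close>

lemma kneser_arrows_bound:
  fixes s r :: nat
  assumes "s \<ge> 4" "r \<ge> 1"
  defines "N \<equiv> r * ramsey_number (s - 2) s + 2 * (ramsey_number (s - 2) (s - 1) - 1) + 2 * r"
  shows "kneser_arrows N r (s - 1) s"
  unfolding kneser_arrows_def
proof
  fix f :: "nat set set \<Rightarrow> nat"
  assume f: "f \<in> kneser_edges N r \<rightarrow> {..<2}"
  define m where "m = ramsey_number (s - 2) s"
  define l where "l = ramsey_number (s - 2) (s - 1)"
  have l1: "1 \<le> l"
    using ramsey_number_ge[of "s - 2" "s - 1"] assms(1) unfolding l_def by linarith
  have lm: "l \<le> m"
    unfolding l_def m_def by (rule ramsey_number_mono_right) simp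
  have sm: "s \<le> m"
    using ramsey_number_ge[of "s - 2" s] assms(1) by (simp add: m_def)
  define V where "V = kneser_vertices N r"
  \<comment> \<open>Disjointness replaces adjacency here, so that subfamilies of a matching qualify
    directly.\<close>
  define mono where "mono i H \<longleftrightarrow>
    finite H \<and> H \<subseteq> V \<and> pairwise disjnt H \<and> (\<forall>e \<in> nsets H 2. f e = i)" for i H
  have card_V: "card A = r" "finite A" "A \<noteq> {}" if "A \<in> V" for A
    using that assms(2) by (auto simp: V_def kneser_vertices_def nsets_def)
  have edge: "{A, B} \<in> kneser_edges N r" if "A \<in> V" "B \<in> V" "disjnt A B" for A B
  proof -
    have "A \<noteq> B" using that(3) card_V(3)[OF that(1)] by (auto simp: disjnt_def)
    thus ?thesis using that unfolding kneser_edges_def V_def disjnt_def by blast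
  qed
  have mono_clique: "monochromatic_clique V (kneser_edges N r) f i k" if "mono i H" "card H = k" for i H k
    unfolding monochromatic_clique_def
  proof (rule bexI[of _ H], rule ballI)
    fix e assume e: "e \<in> nsets H 2"
    then obtain A B where AB: "e = {A, B}" "A \<in> H" "B \<in> H" "A \<noteq> B" by (rule nsets2_E)
    hence "{A, B} \<in> kneser_edges N r"
      using that(1) by (intro edge) (auto simp: mono_def pairwise_def)
    thus "e \<in> kneser_edges N r \<and> f e = i"
      using e AB(1) that(1) by (simp add: mono_def)
  qed (use that in \<open>simp add: nsets_def mono_def\<close>)
  have mono_insert: "mono i (insert A H) \<and> card (insert A H) = Suc (card H)"
    if "mono i H" "A \<in> V" "\<And>F. F \<in> H \<Longrightarrow> disjnt A F \<and> f {A, F} = i" for i A H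
  proof -
    have "A \<notin> H" using that(3)[of A] card_V(3)[OF that(2)] by (auto simp: disjnt_def)
    moreover have "f e = i" if e: "e \<in> nsets (insert A H) 2" for e
    proof -
      obtain B C where BC: "e = {B, C}" "B \<in> insert A H" "C \<in> insert A H" "B \<noteq> C"
        using e by (rule nsets2_E)
      consider "B = A" "C \<in> H" | "C = A" "B \<in> H" | "e \<in> nsets H 2"
        using BC by auto
      thus ?thesis
      proof cases
        case 2
        thus ?thesis using BC(1) \<open>\<And>F. F \<in> H \<Longrightarrow> disjnt A F \<and> f {A, F} = i\<close>[of B]
          by (simp add: insert_commute)
      qed (use BC(1) that \<open>mono i H\<close> \<open>\<And>F. F \<in> H \<Longrightarrow> disjnt A F \<and> f {A, F} = i\<close> in
           \<open>auto simp: mono_def\<close>)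
    qed
    moreover have "pairwise disjnt (insert A H)"
      using that by (auto simp: pairwise_insert mono_def disjnt_sym)
    ultimately show ?thesis using that by (auto simp: mono_def)
  qed
  have "monochromatic_clique V (kneser_edges N r) f 0 (s - 1) \<or>
        monochromatic_clique V (kneser_edges N r) f 1 s"
  proof (cases "\<exists>A C. A \<in> V \<and> C \<in> V \<and> disjnt A C \<and> f {A, C} = 1")
    case False
    have zero: "f {A, B} = 0" if "A \<in> V" "B \<in> V" "disjnt A B" for A B
    proof -
      have "f {A, B} < 2" using funcset_mem[OF f edge[OF that]] by simp
      moreover have "f {A, B} \<noteq> 1" using False that by blast
      ultimately show ?thesis by simp
    qed
    \<comment> \<open>Without a blue edge, any \<open>s - 1\<close> pairwise disjoint sets form a
      red clique. They come from the hypergraph theorem with a single colour,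
      \<open>t = 1\<close>.\<close>
    have "(s - 1) * r + (1 - 1) * (s - 1 - 1) \<le> card {1..N}"
    proof -
      have "(s - 1) * r \<le> m * r" using sm by (intro mult_right_mono) simp_all
      also have "\<dots> \<le> N" by (simp add: N_def m_def mult.commute)
      finally show ?thesis by simp
    qed
    moreover have "1 \<le> s - 1" using assms(1) by linarith
    ultimately obtain M where M: "M \<subseteq> V" "finite M" "card M = s - 1" "pairwise disjnt M"
      using kneser_hypergraph[of "s - 1" r 1 "{1..N}" "\<lambda>_. 0"] assms(1,2)
      unfolding has_matching_def V_def kneser_vertices_def by auto
    have "f e = 0" if e: "e \<in> nsets M 2" for e
    proof -
      obtain A B where AB: "e = {A, B}" "A \<in> M" "B \<in> M" "A \<noteq> B" using e by (rule nsets2_E)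
      hence "disjnt A B" using M(4) by (simp add: pairwise_def)
      thus ?thesis unfolding AB(1) using AB(2,3) M(1) by (intro zero) auto
    qed
    hence "mono 0 M" using M by (simp add: mono_def)
    thus ?thesis using mono_clique M(3) by blast
  next
    case True
    then obtain A C where AC: "A \<in> V" "C \<in> V" "disjnt A C" "f {A, C} = 1" by blast
    define W where "W = {1..N} - A - C"
    define h where "h F = (if f {A, F} = 0 then 0 else if f {C, F} = 0 then 1 else 2 :: nat)" for F
    have "card W = r * m + 2 * (l - 1)"
    proof -
      have "A \<subseteq> {1..N}" "C \<subseteq> {1..N} - A"
        using AC(1-3) by (auto simp: V_def kneser_vertices_def nsets_def disjnt_def)
      hence "card W = N - r - r"
        using card_V[OF AC(1)] card_V[OF AC(2)] by (simp add: W_def card_Diff_subset)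
      thus ?thesis by (simp add: N_def m_def l_def)
    qed
    \<comment> \<open>The sizes are \<open>m\<close>, \<open>l\<close>, \<open>l\<close> and
      \<open>K = m\<close>. The size condition holds with equality: the \<open>m - 1\<close> of
      colour 0 cancels against \<open>K - 1\<close>, leaving
      \<open>r * m + 2 * (l - 1)\<close>.\<close>
    hence "\<exists>c<3. has_matching W r h c (if c = 0 then m else l)"
      using l1 lm assms(2)
      by (intro kneser_hypergraph_unequal[of m]) (auto simp: W_def h_def numeral_3_eq_3)
    then obtain c M where c: "c < 3" and M: "M \<subseteq> nsets W r" "finite M"
      "card M = (if c = 0 then m else l)" "pairwise disjnt M" "\<forall>F \<in> M. h F = c"
      unfolding has_matching_def by blast
    have M_V: "F \<in> V" "disjnt A F" "disjnt C F" if "F \<in> M" for F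
      using M(1) that by (auto simp: V_def kneser_vertices_def nsets_def W_def disjnt_def)
    have two: "f {B, F} < 2" if "B \<in> V" "F \<in> V" "disjnt B F" for B F
      using funcset_mem[OF f edge[OF that]] by simp
    have colours: "f {A, F} = (if c = 0 then 0 else 1)" "c \<noteq> 0 \<Longrightarrow> f {C, F} = c - 1" if F: "F \<in> M" for F
    proof -
      have "f {A, F} < 2" "f {C, F} < 2"
        using two[OF AC(1) M_V(1,2)[OF F]] two[OF AC(2) M_V(1,3)[OF F]] .
      thus "f {A, F} = (if c = 0 then 0 else 1)" "c \<noteq> 0 \<Longrightarrow> f {C, F} = c - 1"
        using M(5) F by (auto simp: h_def split: if_splits)
    qed
    have f2: "f e < 2" if e: "e \<in> nsets M 2" for e
    proof -
      obtain A B where AB: "e = {A, B}" "A \<in> M" "B \<in> M" "A \<noteq> B" using e by (rule nsets2_E)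
      hence "disjnt A B" using M(4) by (simp add: pairwise_def)
      thus ?thesis unfolding AB(1) using AB(2,3) by (intro two M_V(1))
    qed
    have monoI: "mono i H \<and> card H = k" if "H \<in> nsets M k" "\<forall>e \<in> nsets H 2. f e = i" for i H k
      using that M(4) M_V(1) unfolding mono_def nsets_def
      by (auto intro: pairwise_subset)
    have in_M: "F \<in> M" if "H \<in> nsets M k" "F \<in> H" for F H k
      using that by (auto simp: nsets_def)
    have extend: "mono i (insert B H) \<and> card (insert B H) = Suc k"
      if "H \<in> nsets M k" "\<forall>e \<in> nsets H 2. f e = i" "B = A \<or> B = C" "\<And>F. F \<in> M \<Longrightarrow> f {B, F} = i"
      for i B H k
    proof -
      have "mono i (insert B H) \<and> card (insert B H) = Suc (card H)"
      proof (rule mono_insert)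
        show "mono i H" using monoI[OF that(1,2)] by simp
        show "B \<in> V" using that(3) AC by blast
        show "disjnt B F \<and> f {B, F} = i" if "F \<in> H" for F
          using in_M[OF \<open>H \<in> nsets M k\<close> that] M_V \<open>B = A \<or> B = C\<close> \<open>\<And>F. F \<in> M \<Longrightarrow> f {B, F} = i\<close>
          by blast
      qed
      thus ?thesis using monoI[OF that(1,2)] by simp
    qed
    have Suc: "Suc (s - 2) = s - 1" "Suc (s - 1) = s" using assms(1) by simp_all
    consider "c = 0" | "c = 1" | "c = 2" using c by linarith
    thus ?thesis
    proof cases
      case 1
      hence "card M = ramsey_number (s - 2) s" using M(3) by (simp add: m_def)
      from ramsey_number_clique[where g = f, OF M(2) this f2]
      consider H where "H \<in> nsets M (s - 2)" "\<forall>e \<in> nsets H 2. f e = 0"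
        | H where "H \<in> nsets M s" "\<forall>e \<in> nsets H 2. f e = 1" by blast
      thus ?thesis
      proof cases
        case (1 H)
        hence "mono 0 (insert A H) \<and> card (insert A H) = s - 1"
          using extend[OF 1, of A] colours(1) \<open>c = 0\<close> Suc(1) by simp
        thus ?thesis using mono_clique by blast
      next
        case (2 H)
        thus ?thesis using monoI mono_clique by blast
      qed
    next
      \<comment> \<open>Here \<open>A\<close> is joined to \<open>M\<close> in blue and
        \<open>C\<close> in red, so blue cliques are extended by \<open>A\<close> and red ones by
        \<open>C\<close>.\<close>
      case 2
      hence "card M = ramsey_number (s - 2) (s - 1)" using M(3) by (simp add: l_def)
      from ramsey_number_clique[where g = f, OF M(2) this f2]
      consider H where "H \<in> nsets M (s - 2)" "\<forall>e \<in> nsets H 2. f e = 0"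
        | H where "H \<in> nsets M (s - 1)" "\<forall>e \<in> nsets H 2. f e = 1" by blast
      thus ?thesis
      proof cases
        case (1 H)
        hence "mono 0 (insert C H) \<and> card (insert C H) = s - 1"
          using extend[OF 1, of C] colours(2) \<open>c = 1\<close> Suc(1) by simp
        thus ?thesis using mono_clique by blast
      next
        case (2 H)
        hence "mono 1 (insert A H) \<and> card (insert A H) = s"
          using extend[OF 2, of A] colours(1) \<open>c = 1\<close> Suc(2) by simp
        thus ?thesis using mono_clique by blast
      qed
    next
      case 3
      hence "card M = ramsey_number (s - 2) (s - 1)" using M(3) by (simp add: l_def)
      \<comment> \<open>The colours are exchanged: a blue clique gains both \<open>A\<close> and
        \<open>C\<close>, because \<open>{A, C}\<close> is blue, and so needs only
        \<open>s - 2\<close> sets from \<open>M\<close>.\<close>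
      hence "(\<exists>H \<in> nsets M (s - 2). \<forall>e \<in> nsets H 2. 1 - f e = 0) \<or>
             (\<exists>H \<in> nsets M (s - 1). \<forall>e \<in> nsets H 2. 1 - f e = 1)"
        by (intro ramsey_number_clique[OF M(2)]) (simp_all add: less_Suc_eq_le numeral_2_eq_2)
      then consider H where "H \<in> nsets M (s - 2)" "\<forall>e \<in> nsets H 2. 1 - f e = 0"
        | H where "H \<in> nsets M (s - 1)" "\<forall>e \<in> nsets H 2. 1 - f e = 1"
        by blast
      thus ?thesis
      proof cases
        case (1 H)
        \<comment> \<open>With truncated subtraction \<open>1 - f e = 0\<close> only says
          \<open>f e \<ge> 1\<close>; the bound \<open>f2\<close> gives equality.\<close>
        have "f e = 1" if "e \<in> nsets H 2" for e
        proof -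
          have "e \<in> nsets M 2" using that 1(1) nsets_mono[of H M 2] by (auto simp: nsets_def)
          thus ?thesis using f2[of e] 1(2) that by force
        qed
        hence H: "mono 1 (insert A H)" "card (insert A H) = s - 1"
          using extend[OF 1(1), of 1 A] colours(1) \<open>c = 2\<close> Suc(1) by simp_all
        have "mono 1 (insert C (insert A H)) \<and> card (insert C (insert A H)) = Suc (card (insert A H))"
          using H(1) AC(2)
        proof (rule mono_insert)
          fix F assume "F \<in> insert A H"
          thus "disjnt C F \<and> f {C, F} = 1"
            using AC(3,4) in_M[OF 1(1)] M_V(3) colours(2) \<open>c = 2\<close>
              disjnt_sym[of A C] insert_commute[of A C "{}"]
            by auto
        qed
        thus ?thesis using mono_clique H(2) Suc(2) by metis
      next
        case (2 H)
        have "f e = 0" if "e \<in> nsets H 2" for e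
        proof -
          have "1 - f e = 1" using 2(2) that by blast
          thus ?thesis by simp
        qed
        thus ?thesis using monoI[OF 2(1)] mono_clique by blast
      qed
    qed
  qed
  thus "monochromatic_clique (kneser_vertices N r) (kneser_edges N r) f 0 (s - 1) \<or>
        monochromatic_clique (kneser_vertices N r) (kneser_edges N r) f 1 s"
    by (simp only: V_def)
qed

theorem theorem1p8:
  fixes s r :: nat
  assumes "s \<ge> 4" and "r \<ge> 1"
  shows "int (kneser_ramsey_number r (s - 1) s)
       \<le> int r * int (ramsey_number (s - 2) s)
         + 2 * (int (ramsey_number (s - 2) (s - 1)) - 1) + 2 * int r"
proof -
  have "kneser_ramsey_number r (s - 1) s
      \<le> r * ramsey_number (s - 2) s + 2 * (ramsey_number (s - 2) (s - 1) - 1) + 2 * r"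
    unfolding kneser_ramsey_number_def by (rule Least_le) (rule kneser_arrows_bound[OF assms])
  \<comment> \<open>This makes the truncated difference in \<open>kneser_arrows_bound\<close> agree
    with the integer one.\<close>
  moreover have "1 \<le> ramsey_number (s - 2) (s - 1)"
    using ramsey_number_ge[of "s - 2" "s - 1"] assms(1) by linarith
  ultimately show ?thesis
    by (simp add: of_nat_diff flip: of_nat_mult of_nat_add) linarith
qed

end
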